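(* Let $d\ge 1$. Consider a discrete-time birth-and-death chain with kernel $P^*$ on $\{0, \dots, d\}$ started at $0$, and suppose that $d$ is an absorbing state. Write $q^*_i$, $r^*_i$, and $p^*_i$ for its death, hold, and birth probabilities, respectively. Suppose that $p^*_i > 0$ for $0 \le i \le d - 1$, that $q^*_i > 0$ for $1 \le i \le d-1$, and that $p^*_{i - 1} + q^*_i < 1$ for $1 \le i \le d$. Then $P^*$ is the classical (and hence sharp) strong stationary dual of some monotone ergodic birth-and-death kernel $P$ on $\{0, \dots, d\}$ (with both chains started at $0$).
   Context: A discrete-time birth-and-death kernel on $\{0,\dots,d\}$ with death, hold, birth probabilities $q_i,r_i,p_i$ is the tridiagonal stochastic matrix with $P(i,i-1)=q_i$, $P(i,i)=r_i$, $P(i,i+1)=p_i$, $q_0=0$, $p_d=0$. Ergodic means irreducible and aperiodic. A kernel $P$ is monotone if $\sum_{k>j}P(i,k)$ is nondecreasing in $i$ for each $j$; for a birth-and-death kernel this is equivalent to $p_{i-1}+q_i\le 1$ for $1\le i\le d$. Strong stationary duality: let $P$ be ergodic with stationary distribution $\pi$, let $P^*$ be a kernel with $d$ absorbing, and let $\Lambda$ (the link) be a stochastic matrix with $\Lambda(0,\cdot)=\delta_0$ and $\Lambda(d,\cdot)=\pi$ (all on $\{0,\dots,d\}$). With both chains started at $0$, $P^*$ is a strong stationary dual of $P$ with respect to $\Lambda$ if $\Lambda P = P^*\Lambda$. A strong stationary time for a chain $X$ with kernel $P$ is an a.s. finite randomized stopping time $T$ for $X$ (that is, a stopping time with respect to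 some filtration to which $X$ is adapted and with respect to which $X$ is Markov with kernel $P$) such that $X_T$ has distribution $\pi$ and is independent of $T$; it is fastest if it is stochastically minimal among all strong stationary times for $X$ (i.e., for the chain with kernel $P$ and the same initial distribution). The dual is called sharp if there is a bivariate Markov chain $(X^*,X)$ such that $X$ is marginally Markov with kernel $P$ started at $0$, $X^*$ is marginally Markov with kernel $P^*$ started at $0$, and the absorption time $T^*$ of $X^*$ in state $d$ is a fastest strong stationary time for $X$. Classical strong stationary dual: with $H_j=\sum_{i\le j}\pi_i$ the stationary cumulative distribution function of $P$, the link of truncated stationary distributions is $\Lambda(x^*,x)=\mathbf{1}(x\le x^* )\,\pi_x/H_{x^*}$. $P^*$ is the classical strong stationary dual of $P$ if it is the strong stationary dual of $P$ with respect to this link; for birth-and-death $P$ this says that $P^*$ is birth-and-death with $q^*_i=\frac{H_{i-1}}{H_i}p_i$, $r^*_i=1-(p_i+q_{i+1})$, $p^*_i=\frac{H_{i+1}}{H_i}q_{i+1}$ (with $H_{-1}:=0$, $q_{d+1}:=0$). *)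

theory Defs
  imports "HOL-Probability.Probability"
begin

section \<open>Kernels on a finite state space\<close>

text \<open>Kernels and probability vectors on a finite set \<open>S\<close> are real-valued functions of which only
  the values on \<open>S\<close> matter.  The state space \<open>{0, \<dots>, d}\<close> is \<open>{..d}\<close>.\<close>

definition stochastic_on :: "'s set \<Rightarrow> ('s \<Rightarrow> 's \<Rightarrow> real) \<Rightarrow> bool" where
  "stochastic_on S P \<longleftrightarrow> (\<forall>i\<in>S. (\<forall>j\<in>S. 0 \<le> P i j) \<and> (\<Sum>j\<in>S. P i j) = 1)"

definition birth_death_kernel ::
  "nat \<Rightarrow> (nat \<Rightarrow> real) \<Rightarrow> (nat \<Rightarrow> real) \<Rightarrow> (nat \<Rightarrow> real) \<Rightarrow> (nat \<Rightarrow> nat \<Rightarrow> real) \<Rightarrow> bool" where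
  "birth_death_kernel d q r p P \<longleftrightarrow>
     stochastic_on {..d} P \<and> q 0 = 0 \<and> p d = 0 \<and>
     (\<forall>i\<le>d. \<forall>j\<le>d. P i j =
        (if i = Suc j then q i else if i = j then r i else if j = Suc i then p i else 0))"

definition kernel_mult ::
  "nat \<Rightarrow> (nat \<Rightarrow> nat \<Rightarrow> real) \<Rightarrow> (nat \<Rightarrow> nat \<Rightarrow> real) \<Rightarrow> nat \<Rightarrow> nat \<Rightarrow> real" where
  "kernel_mult d A B i j = (\<Sum>k\<le>d. A i k * B k j)"

fun kernel_power :: "nat \<Rightarrow> (nat \<Rightarrow> nat \<Rightarrow> real) \<Rightarrow> nat \<Rightarrow> nat \<Rightarrow> nat \<Rightarrow> real" where
  "kernel_power d P 0 = (\<lambda>i j. of_bool (i = j))"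
| "kernel_power d P (Suc n) = kernel_mult d P (kernel_power d P n)"

definition irreducible_kernel :: "nat \<Rightarrow> (nat \<Rightarrow> nat \<Rightarrow> real) \<Rightarrow> bool" where
  "irreducible_kernel d P \<longleftrightarrow> (\<forall>i\<le>d. \<forall>j\<le>d. \<exists>n. 0 < kernel_power d P n i j)"

definition aperiodic_kernel :: "nat \<Rightarrow> (nat \<Rightarrow> nat \<Rightarrow> real) \<Rightarrow> bool" where
  "aperiodic_kernel d P \<longleftrightarrow> (\<forall>i\<le>d. Gcd {n. 0 < n \<and> 0 < kernel_power d P n i i} = 1)"

definition ergodic_kernel :: "nat \<Rightarrow> (nat \<Rightarrow> nat \<Rightarrow> real) \<Rightarrow> bool" where
  "ergodic_kernel d P \<longleftrightarrow>
     stochastic_on {..d} P \<and> irreducible_kernel d P \<and> aperiodic_kernel d P"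

definition monotone_kernel :: "nat \<Rightarrow> (nat \<Rightarrow> nat \<Rightarrow> real) \<Rightarrow> bool" where
  "monotone_kernel d P \<longleftrightarrow>
     (\<forall>j\<le>d. \<forall>i i'. i \<le> i' \<and> i' \<le> d \<longrightarrow> (\<Sum>k\<in>{j<..d}. P i k) \<le> (\<Sum>k\<in>{j<..d}. P i' k))"

definition stationary_distribution :: "nat \<Rightarrow> (nat \<Rightarrow> nat \<Rightarrow> real) \<Rightarrow> (nat \<Rightarrow> real) \<Rightarrow> bool" where
  "stationary_distribution d P \<pi> \<longleftrightarrow>
     (\<forall>i\<le>d. 0 \<le> \<pi> i) \<and> (\<Sum>i\<le>d. \<pi> i) = 1 \<and> (\<forall>j\<le>d. (\<Sum>i\<le>d. \<pi> i * P i j) = \<pi> j)"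

definition absorbing_state :: "nat \<Rightarrow> (nat \<Rightarrow> nat \<Rightarrow> real) \<Rightarrow> bool" where
  "absorbing_state i P \<longleftrightarrow> P i i = 1"


section \<open>Strong stationary duality\<close>

text \<open>The conditions on rows \<open>0\<close> and \<open>d\<close> of the link encode that both chains start at \<open>0\<close> and that
  absorption of the dual in \<open>d\<close> corresponds to stationarity.\<close>

definition strong_stationary_dual ::
  "nat \<Rightarrow> (nat \<Rightarrow> nat \<Rightarrow> real) \<Rightarrow> (nat \<Rightarrow> real) \<Rightarrow> (nat \<Rightarrow> nat \<Rightarrow> real) \<Rightarrow> (nat \<Rightarrow> nat \<Rightarrow> real) \<Rightarrow> bool"
where
  "strong_stationary_dual d P \<pi> \<Lambda> Pstar \<longleftrightarrow>
     ergodic_kernel d P \<and> stationary_distribution d P \<pi> \<and>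
     stochastic_on {..d} Pstar \<and> absorbing_state d Pstar \<and>
     stochastic_on {..d} \<Lambda> \<and>
     (\<forall>j\<le>d. \<Lambda> 0 j = of_bool (j = 0)) \<and> (\<forall>j\<le>d. \<Lambda> d j = \<pi> j) \<and>
     (\<forall>i\<le>d. \<forall>j\<le>d. kernel_mult d \<Lambda> P i j = kernel_mult d Pstar \<Lambda> i j)"

definition truncated_link :: "(nat \<Rightarrow> real) \<Rightarrow> nat \<Rightarrow> nat \<Rightarrow> real" where
  "truncated_link \<pi> xs x = (if x \<le> xs then \<pi> x / (\<Sum>i\<le>xs. \<pi> i) else 0)"

definition classical_ssd ::
  "nat \<Rightarrow> (nat \<Rightarrow> nat \<Rightarrow> real) \<Rightarrow> (nat \<Rightarrow> real) \<Rightarrow> (nat \<Rightarrow> nat \<Rightarrow> real) \<Rightarrow> bool" where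
  "classical_ssd d P \<pi> Pstar \<longleftrightarrow> strong_stationary_dual d P \<pi> (truncated_link \<pi>) Pstar"


section \<open>Markov chains and strong stationary times\<close>

definition markov_wrt ::
  "'w measure \<Rightarrow> (nat \<Rightarrow> 'w measure) \<Rightarrow> 's set \<Rightarrow> ('s \<Rightarrow> real) \<Rightarrow> ('s \<Rightarrow> 's \<Rightarrow> real) \<Rightarrow>
   (nat \<Rightarrow> 'w \<Rightarrow> 's) \<Rightarrow> bool" where
  "markov_wrt M F S \<mu> P X \<longleftrightarrow>
     prob_space M \<and> filtration (space M) F \<and> (\<forall>n. subalgebra M (F n)) \<and>
     (\<forall>n. X n \<in> F n \<rightarrow>\<^sub>M count_space S) \<and>
     (\<forall>s\<in>S. measure M {\<omega>\<in>space M. X 0 \<omega> = s} = \<mu> s) \<and>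
     (\<forall>n. \<forall>s\<in>S. AE \<omega> in M.
        real_cond_exp M (F n) (indicator {\<omega>\<in>space M. X (Suc n) \<omega> = s}) \<omega> = P (X n \<omega>) s)"

definition natural_filtration ::
  "'w measure \<Rightarrow> 's set \<Rightarrow> (nat \<Rightarrow> 'w \<Rightarrow> 's) \<Rightarrow> nat \<Rightarrow> 'w measure" where
  "natural_filtration M S X n =
     sigma (space M) {X i -` A \<inter> space M | i A. i \<le> n \<and> A \<subseteq> S}"

definition markov_chain ::
  "'w measure \<Rightarrow> 's set \<Rightarrow> ('s \<Rightarrow> real) \<Rightarrow> ('s \<Rightarrow> 's \<Rightarrow> real) \<Rightarrow> (nat \<Rightarrow> 'w \<Rightarrow> 's) \<Rightarrow> bool" where
  "markov_chain M S \<mu> P X \<longleftrightarrow> markov_wrt M (natural_filtration M S X) S \<mu> P X"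

text \<open>Times take values in \<^typ>\<open>enat\<close>; on the null event where \<open>T = \<infinity>\<close> the value of
  \<^term>\<open>the_enat (T \<omega>)\<close> is irrelevant.\<close>

definition strong_stationary_time ::
  "'w measure \<Rightarrow> 's set \<Rightarrow> ('s \<Rightarrow> real) \<Rightarrow> ('s \<Rightarrow> 's \<Rightarrow> real) \<Rightarrow> ('s \<Rightarrow> real) \<Rightarrow>
   (nat \<Rightarrow> 'w \<Rightarrow> 's) \<Rightarrow> ('w \<Rightarrow> enat) \<Rightarrow> bool" where
  "strong_stationary_time M S \<mu> P \<pi> X T \<longleftrightarrow>
     (\<exists>F. markov_wrt M F S \<mu> P X \<and> (\<forall>n. {\<omega>\<in>space M. T \<omega> \<le> enat n} \<in> sets (F n))) \<and>
     (AE \<omega> in M. T \<omega> < \<infinity>) \<and>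
     (\<forall>s\<in>S. measure M {\<omega>\<in>space M. X (the_enat (T \<omega>)) \<omega> = s} = \<pi> s) \<and>
     prob_space.indep_set M
       {(\<lambda>\<omega>. X (the_enat (T \<omega>)) \<omega>) -` A \<inter> space M | A. A \<subseteq> S}
       {T -` B \<inter> space M | B. B \<subseteq> UNIV}"

text \<open>HOL cannot quantify over sample spaces of all types inside a definition.  Whether \<open>U\<close> is a
  strong stationary time for \<open>Y\<close>, and the law of \<open>U\<close>, depend only on the joint law of \<open>(Y, U)\<close>, so the
  competitors are taken on the canonical sample space of pairs (path, time);
  \<open>fastest_sst_any_space\<close> below shows that this loses nothing.\<close>

definition fastest_sst ::
  "'w measure \<Rightarrow> 's set \<Rightarrow> ('s \<Rightarrow> real) \<Rightarrow> ('s \<Rightarrow> 's \<Rightarrow> real) \<Rightarrow> ('s \<Rightarrow> real) \<Rightarrow>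
   (nat \<Rightarrow> 'w \<Rightarrow> 's) \<Rightarrow> ('w \<Rightarrow> enat) \<Rightarrow> bool" where
  "fastest_sst M S \<mu> P \<pi> X T \<longleftrightarrow>
     strong_stationary_time M S \<mu> P \<pi> X T \<and>
     (\<forall>(N :: ((nat \<Rightarrow> 's) \<times> enat) measure) Y U.
        strong_stationary_time N S \<mu> P \<pi> Y U \<longrightarrow>
        (\<forall>n. measure M {\<omega>\<in>space M. enat n < T \<omega>} \<le> measure N {\<omega>\<in>space N. enat n < U \<omega>}))"

definition absorption_time :: "nat \<Rightarrow> (nat \<Rightarrow> 'w \<Rightarrow> nat) \<Rightarrow> 'w \<Rightarrow> enat" where
  "absorption_time d X \<omega> = Inf (enat ` {n. X n \<omega> = d})"

definition sharp_dual ::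
  "nat \<Rightarrow> (nat \<Rightarrow> nat \<Rightarrow> real) \<Rightarrow> (nat \<Rightarrow> real) \<Rightarrow> (nat \<Rightarrow> nat \<Rightarrow> real) \<Rightarrow> bool" where
  "sharp_dual d P \<pi> Pstar \<longleftrightarrow>
     (\<exists>(M :: (nat \<Rightarrow> nat \<times> nat) measure) Xstar X Q.
        stochastic_on ({..d} \<times> {..d}) Q \<and>
        markov_chain M ({..d} \<times> {..d}) (\<lambda>s. of_bool (s = (0, 0))) Q (\<lambda>n \<omega>. (Xstar n \<omega>, X n \<omega>)) \<and>
        markov_chain M {..d} (\<lambda>s. of_bool (s = 0)) P X \<and>
        markov_chain M {..d} (\<lambda>s. of_bool (s = 0)) Pstar Xstar \<and>
        fastest_sst M {..d} (\<lambda>s. of_bool (s = 0)) P \<pi> X (absorption_time d Xstar))"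


section \<open>Independence of the sample space\<close>

lemma strong_stationary_time_canonical:
  fixes M :: "'v measure" and X :: "nat \<Rightarrow> 'v \<Rightarrow> 's"
  assumes sst: "strong_stationary_time M S \<mu> P \<pi> X T"
  defines "N \<equiv> distr M (PiM UNIV (\<lambda>_. count_space S) \<Otimes>\<^sub>M count_space UNIV) (\<lambda>\<omega>. (\<lambda>n. X n \<omega>, T \<omega>))"
  shows "strong_stationary_time N S \<mu> P \<pi> (\<lambda>n \<omega>. fst \<omega> n) snd"
    and "measure N {\<omega>\<in>space N. enat n < snd \<omega>} = measure M {\<omega>\<in>space M. enat n < T \<omega>}"
proof -
  let ?K = "PiM UNIV (\<lambda>_::nat. count_space S) \<Otimes>\<^sub>M (count_space UNIV :: enat measure)"
  let ?f = "\<lambda>\<omega>. (\<lambda>n. X n \<omega>, T \<omega>)"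
  obtain F where mk: "markov_wrt M F S \<mu> P X"
    and stop: "\<And>n. {\<omega>\<in>space M. T \<omega> \<le> enat n} \<in> sets (F n)"
    using sst unfolding strong_stationary_time_def by blast
  interpret prob_space M using mk by (simp add: markov_wrt_def)
  have filt: "filtration (space M) F" and sub: "\<And>n. subalgebra M (F n)"
    and ad: "\<And>n. X n \<in> F n \<rightarrow>\<^sub>M count_space S"
    and init: "\<And>s. s \<in> S \<Longrightarrow> measure M {\<omega>\<in>space M. X 0 \<omega> = s} = \<mu> s"
    and ce: "\<And>n s. s \<in> S \<Longrightarrow> AE \<omega> in M.
        real_cond_exp M (F n) (indicator {\<omega>\<in>space M. X (Suc n) \<omega> = s}) \<omega> = P (X n \<omega>) s"
    using mk unfolding markov_wrt_def by blast+
  have spF: "space (F n) = space M" and stF: "sets (F n) \<subseteq> sets M" for n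
    using sub by (auto simp: subalgebra_def)
  have X[measurable]: "X n \<in> M \<rightarrow>\<^sub>M count_space S" for n
    using ad sub measurable_from_subalg by blast
  have T[measurable]: "T \<in> M \<rightarrow>\<^sub>M count_space UNIV"
  proof (rule measurable_count_space_eq2_countable[THEN iffD2], intro conjI ballI)
    have le: "{\<omega>\<in>space M. T \<omega> \<le> enat n} \<in> sets M" for n using stop stF by blast
    have fin: "T -` {enat n} \<inter> space M \<in> sets M" for n
    proof (cases n)
      case 0
      then have "T -` {enat n} \<inter> space M = {\<omega>\<in>space M. T \<omega> \<le> enat 0}"
        by (auto simp: enat_0)
      then show ?thesis using le by simp
    next
      case (Suc m)
      have "T -` {enat n} \<inter> space M = {\<omega>\<in>space M. T \<omega> \<le> enat n} - {\<omega>\<in>space M. T \<omega> \<le> enat m}"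
      proof -
        have "t = enat n \<longleftrightarrow> t \<le> enat n \<and> \<not> t \<le> enat m" for t
          using Suc by (cases t) auto
        then show ?thesis by auto
      qed
      then show ?thesis using le by auto
    qed
    fix a :: enat
    show "T -` {a} \<inter> space M \<in> sets M"
    proof (cases a)
      case (enat n) then show ?thesis using fin by simp
    next
      case infinity
      have "T -` {a} \<inter> space M = space M - (\<Union>n. T -` {enat n} \<inter> space M)"
        using infinity by (auto simp: not_infinity_eq)
      moreover have "(\<Union>n. T -` {enat n} \<inter> space M) \<in> sets M"
        using fin by (intro sets.countable_UN) blast
      ultimately show ?thesis by (metis sets.compl_sets)
    qed
  qed auto
  have XS: "X n \<omega> \<in> S" if "\<omega> \<in> space M" for n \<omega>
    using measurable_space[OF X that] by simp
  have f[measurable]: "?f \<in> M \<rightarrow>\<^sub>M ?K"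
    by (intro measurable_Pair measurable_PiM_single') (auto simp: space_PiM PiE_def XS)
  have spN: "space N = space ?K" and stN: "sets N = sets ?K" by (simp_all add: N_def)
  have fN[measurable]: "?f \<in> M \<rightarrow>\<^sub>M N" using f by (simp add: N_def)
  interpret N: prob_space N unfolding N_def by (rule prob_space_distr) (rule f)
  have Y[measurable]: "(\<lambda>\<omega>. fst \<omega> n) \<in> N \<rightarrow>\<^sub>M count_space S" for n
    unfolding N_def by measurable
  have U[measurable]: "snd \<in> N \<rightarrow>\<^sub>M count_space UNIV"
    unfolding N_def by measurable
  have mN: "measure N {\<omega>\<in>space N. Q \<omega>} = measure M {\<omega>\<in>space M. Q (?f \<omega>)}"
    if "{\<omega>\<in>space N. Q \<omega>} \<in> sets N" for Q
  proof -
    have "measure N {\<omega>\<in>space N. Q \<omega>} = measure M (?f -` {\<omega>\<in>space N. Q \<omega>} \<inter> space M)"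
      using that f by (simp add: N_def measure_distr)
    also have "?f -` {\<omega>\<in>space N. Q \<omega>} \<inter> space M = {\<omega>\<in>space M. Q (?f \<omega>)}"
      using measurable_space[OF fN] by auto
    finally show ?thesis .
  qed
  have YUm: "(\<lambda>\<omega>. fst \<omega> (the_enat (snd \<omega>))) \<in> N \<rightarrow>\<^sub>M count_space S"
    by (rule measurable_compose_countable[where g = "\<lambda>\<omega>. the_enat (snd \<omega>)", OF Y])
      (rule measurable_compose[OF U], simp)
  have YU: "{\<omega>\<in>space N. fst \<omega> (the_enat (snd \<omega>)) = s} \<in> sets N" if "s \<in> S" for s
    using measurable_sets[OF YUm, of "{s}"] that by (simp add: vimage_def Int_def conj_commute)
  have Ys: "{\<omega>\<in>space N. fst \<omega> n = s} \<in> sets N" if "s \<in> S" for s n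
    using measurable_sets[OF Y, of "{s}" n] that by (simp add: vimage_def Int_def conj_commute)
  define G where "G n = sigma (space N) {A \<in> sets N. ?f -` A \<inter> space M \<in> sets (F n)}" for n
  have salg: "sigma_algebra (space N) {A \<in> sets N. ?f -` A \<inter> space M \<in> sets (F n)}" for n
    unfolding sigma_algebra_iff2
  proof (intro conjI ballI allI impI)
    show "{A \<in> sets N. ?f -` A \<inter> space M \<in> sets (F n)} \<subseteq> Pow (space N)"
      using sets.sets_into_space by auto
    show "{} \<in> {A \<in> sets N. ?f -` A \<inter> space M \<in> sets (F n)}" by simp
  next
    fix A assume A: "A \<in> {A \<in> sets N. ?f -` A \<inter> space M \<in> sets (F n)}"
    have "?f -` (space N - A) \<inter> space M = space (F n) - (?f -` A \<inter> space M)"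
      using measurable_space[OF fN] by (auto simp: spF)
    then show "space N - A \<in> {A \<in> sets N. ?f -` A \<inter> space M \<in> sets (F n)}" using A by auto
  next
    fix A :: "nat \<Rightarrow> _" assume A: "range A \<subseteq> {A \<in> sets N. ?f -` A \<inter> space M \<in> sets (F n)}"
    have "?f -` (\<Union>i. A i) \<inter> space M = (\<Union>i. ?f -` A i \<inter> space M)" by auto
    also have "\<dots> \<in> sets (F n)" using A by (intro sets.countable_UN) auto
    finally show "(\<Union>i. A i) \<in> {A \<in> sets N. ?f -` A \<inter> space M \<in> sets (F n)}" using A by auto
  qed
  have stG: "sets (G n) = {A \<in> sets N. ?f -` A \<inter> space M \<in> sets (F n)}" for n
    unfolding G_def by (rule sigma_algebra.sets_measure_of_eq[OF salg])
  have spG: "space (G n) = space N" for n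
    unfolding G_def by (rule space_measure_of) (use sets.sets_into_space in auto)
  have subG: "subalgebra N (G n)" for n by (auto simp: subalgebra_def stG spG)
  have YG: "(\<lambda>\<omega>. fst \<omega> n) \<in> G n \<rightarrow>\<^sub>M count_space S" for n
  proof (rule measurableI)
    fix A assume "A \<in> sets (count_space S)"
    then have "(\<lambda>\<omega>. fst \<omega> n) -` A \<inter> space N \<in> sets N" "X n -` A \<inter> space (F n) \<in> sets (F n)"
      using measurable_sets[OF Y] measurable_sets[OF ad] by blast+
    moreover have "?f -` ((\<lambda>\<omega>. fst \<omega> n) -` A \<inter> space N) \<inter> space M = X n -` A \<inter> space (F n)"
      using measurable_space[OF fN] by (auto simp: spF)
    ultimately show "(\<lambda>\<omega>. fst \<omega> n) -` A \<inter> space (G n) \<in> sets (G n)" by (simp add: stG spG)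
  qed (use measurable_space[OF Y] in \<open>auto simp: spG\<close>)
  have ceN: "AE \<omega> in N. real_cond_exp N (G n) (indicator {\<omega>\<in>space N. fst \<omega> (Suc n) = s}) \<omega>
      = P (fst \<omega> n) s" if s: "s \<in> S" for n s
  proof -
    interpret GN: finite_measure_subalgebra N "G n"
      by (simp add: finite_measure_subalgebra_def N.finite_measure_axioms
          finite_measure_subalgebra_axioms_def subG)
    interpret FM: finite_measure_subalgebra M "F n"
      by (simp add: finite_measure_subalgebra_def finite_measure_axioms
          finite_measure_subalgebra_axioms_def sub)
    let ?B = "{\<omega>\<in>space N. fst \<omega> (Suc n) = s}" and ?C = "{\<omega>\<in>space M. X (Suc n) \<omega> = s}"
    have B[measurable]: "?B \<in> sets N" using Ys[OF s] .
    have C[measurable]: "?C \<in> sets M"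
      using measurable_sets[OF X, of "{s}" "Suc n"] s by (simp add: vimage_def Int_def conj_commute)
    have BC: "indicator ?B (?f \<omega>) = (indicator ?C \<omega> :: real)" if "\<omega> \<in> space M" for \<omega>
      using that measurable_space[OF fN] by (auto simp: indicator_def)
    have iC: "integrable M (indicator ?C :: _ \<Rightarrow> real)" by (simp add: emeasure_eq_measure)
    have gM[measurable]: "(\<lambda>\<omega>. P (X n \<omega>) s) \<in> borel_measurable M"
      by (rule measurable_compose[OF X]) simp
    have gN[measurable]: "(\<lambda>\<omega>. P (fst \<omega> n) s) \<in> borel_measurable N"
      by (rule measurable_compose[OF Y]) simp
    have ig: "integrable M (\<lambda>\<omega>. P (X n \<omega>) s)"
      by (rule integrable_cong_AE_imp[OF FM.real_cond_exp_int(1)[OF iC] gM])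
        (use ce[OF s, of n] in auto)
    show ?thesis
    proof (rule GN.real_cond_exp_charact)
      show "integrable N (indicator ?B :: _ \<Rightarrow> real)" by (simp add: N.emeasure_eq_measure)
      show "integrable N (\<lambda>\<omega>. P (fst \<omega> n) s)"
        unfolding N_def
      proof (rule integrable_distr_eq[OF f, THEN iffD2])
        show "(\<lambda>\<omega>. P (fst \<omega> n) s) \<in> borel_measurable ?K"
          using gN by (simp only: measurable_cong_sets[OF stN refl])
        show "integrable M (\<lambda>\<omega>. P (fst (?f \<omega>) n) s)" using ig by simp
      qed
      show "(\<lambda>\<omega>. P (fst \<omega> n) s) \<in> borel_measurable (G n)"
        by (rule measurable_compose[OF YG]) simp
      fix A assume "A \<in> sets (G n)"
      then have A[measurable]: "A \<in> sets N" and AF: "?f -` A \<inter> space M \<in> sets (F n)"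
        by (auto simp: stG)
      have tr: "(LINT \<omega>:A|N. h \<omega>) = (LINT \<omega>:(?f -` A \<inter> space M)|M. h (?f \<omega>))"
        if [measurable]: "h \<in> borel_measurable N" for h :: "_ \<Rightarrow> real"
      proof -
        have m: "(\<lambda>\<omega>. indicator A \<omega> *\<^sub>R h \<omega>) \<in> borel_measurable N" by measurable
        have "(LINT \<omega>:A|N. h \<omega>) = (LINT \<omega>|M. indicator A (?f \<omega>) *\<^sub>R h (?f \<omega>))"
          unfolding set_lebesgue_integral_def N_def
          by (rule integral_distr[OF f]) (use m in \<open>simp only: measurable_cong_sets[OF stN refl]\<close>)
        also have "\<dots> = (LINT \<omega>:(?f -` A \<inter> space M)|M. h (?f \<omega>))"
          unfolding set_lebesgue_integral_def by (intro Bochner_Integration.integral_cong) (auto simp: indicator_def)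
        finally show ?thesis .
      qed
      have "(LINT \<omega>:A|N. indicator ?B \<omega>) = (LINT \<omega>:(?f -` A \<inter> space M)|M. (indicator ?B (?f \<omega>)::real))"
        by (rule tr) measurable
      also have "\<dots> = (LINT \<omega>:(?f -` A \<inter> space M)|M. indicator ?C \<omega>)"
        unfolding set_lebesgue_integral_def using BC by (intro Bochner_Integration.integral_cong) auto
      also have "\<dots> = (LINT \<omega>:(?f -` A \<inter> space M)|M. real_cond_exp M (F n) (indicator ?C) \<omega>)"
        by (rule FM.real_cond_exp_intA[OF iC AF])
      also have "\<dots> = (LINT \<omega>:(?f -` A \<inter> space M)|M. P (X n \<omega>) s)"
      proof -
        have [measurable]: "?f -` A \<inter> space M \<in> sets M" using AF stF by blast
        show ?thesis unfolding set_lebesgue_integral_def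
          by (rule integral_cong_AE) (use ce[OF s, of n] in auto)
      qed
      also have "\<dots> = (LINT \<omega>:A|N. P (fst \<omega> n) s)" by (subst tr) auto
      finally show "(LINT \<omega>:A|N. indicator ?B \<omega>) = (LINT \<omega>:A|N. P (fst \<omega> n) s)" .
    qed
  qed
  have filtG: "filtration (space N) G"
  proof
    show "space (G i) = space N" for i by (rule spG)
    show "sets (G i) \<subseteq> sets (G j)" if "i \<le> j" for i j
      using filtration.sets_F_mono[OF filt that] by (auto simp: stG)
  qed
  have mkN: "markov_wrt N G S \<mu> P (\<lambda>n \<omega>. fst \<omega> n)"
    unfolding markov_wrt_def using N.prob_space_axioms filtG subG YG ceN init
    by (auto simp: mN[OF Ys])
  have stopN: "{\<omega>\<in>space N. snd \<omega> \<le> enat n} \<in> sets (G n)" for n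
  proof -
    have "{\<omega>\<in>space N. snd \<omega> \<le> enat n} \<in> sets N" by measurable
    moreover have "?f -` {\<omega>\<in>space N. snd \<omega> \<le> enat n} \<inter> space M = {\<omega>\<in>space M. T \<omega> \<le> enat n}"
      using measurable_space[OF fN] by auto
    ultimately show ?thesis using stop by (simp add: stG)
  qed
  have fin: "AE \<omega> in M. T \<omega> < \<infinity>" using sst by (simp add: strong_stationary_time_def)
  have finN: "AE \<omega> in N. snd \<omega> < \<infinity>"
    unfolding N_def by (subst AE_distr_iff[OF f]) (use fin in \<open>auto\<close>)
  have indep: "indep_set {(\<lambda>\<omega>. X (the_enat (T \<omega>)) \<omega>) -` A \<inter> space M | A. A \<subseteq> S}
      {T -` B \<inter> space M | B. B \<subseteq> UNIV}"
    using sst by (simp add: strong_stationary_time_def)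
  have indepN: "N.indep_set {(\<lambda>\<omega>. fst \<omega> (the_enat (snd \<omega>))) -` A \<inter> space N | A. A \<subseteq> S}
      {snd -` B \<inter> space N | B. B \<subseteq> UNIV}"
    unfolding N.indep_sets2_eq
  proof (intro conjI ballI)
    show "{(\<lambda>\<omega>. fst \<omega> (the_enat (snd \<omega>))) -` A \<inter> space N | A. A \<subseteq> S} \<subseteq> N.events"
      using measurable_sets[OF YUm] by auto
    show "{snd -` B \<inter> space N | B. B \<subseteq> UNIV} \<subseteq> N.events"
      using measurable_sets[OF U] by auto
    fix a b
    assume "a \<in> {(\<lambda>\<omega>. fst \<omega> (the_enat (snd \<omega>))) -` A \<inter> space N | A. A \<subseteq> S}"
      and "b \<in> {snd -` B \<inter> space N | B. B \<subseteq> UNIV}"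
    then obtain A B where A: "A \<subseteq> S" and a: "a = (\<lambda>\<omega>. fst \<omega> (the_enat (snd \<omega>))) -` A \<inter> space N"
      and b: "b = snd -` B \<inter> space N" by blast
    have aN: "a \<in> sets N" and bN: "b \<in> sets N"
      using measurable_sets[OF YUm, of A] measurable_sets[OF U, of B] A by (simp_all add: a b)
    let ?a = "(\<lambda>\<omega>. X (the_enat (T \<omega>)) \<omega>) -` A \<inter> space M" and ?b = "T -` B \<inter> space M"
    have pa: "?f -` a \<inter> space M = ?a" and pb: "?f -` b \<inter> space M = ?b"
      and pab: "?f -` (a \<inter> b) \<inter> space M = ?a \<inter> ?b"
      using measurable_space[OF fN] by (auto simp: a b)
    have pr: "measure N c = measure M (?f -` c \<inter> space M)" if "c \<in> sets N" for c
      using that f by (simp add: N_def measure_distr)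
    have "measure M (?a \<inter> ?b) = measure M ?a * measure M ?b"
      using indep A unfolding indep_sets2_eq by blast
    then show "measure N (a \<inter> b) = measure N a * measure N b"
      using pr[OF aN] pr[OF bN] pr[OF sets.Int[OF aN bN]] by (simp only: pa pb pab)
  qed
  have dist: "measure M {\<omega>\<in>space M. X (the_enat (T \<omega>)) \<omega> = s} = \<pi> s" if "s \<in> S" for s
    using sst that by (simp add: strong_stationary_time_def)
  have distN: "measure N {\<omega>\<in>space N. fst \<omega> (the_enat (snd \<omega>)) = s} = \<pi> s" if "s \<in> S" for s
    using dist[OF that] by (subst mN[OF YU[OF that]]) simp
  show "strong_stationary_time N S \<mu> P \<pi> (\<lambda>n \<omega>. fst \<omega> n) snd"
    unfolding strong_stationary_time_def
    using mkN stopN finN indepN distN by blast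
  show "measure N {\<omega>\<in>space N. enat n < snd \<omega>} = measure M {\<omega>\<in>space M. enat n < T \<omega>}"
  proof -
    have "snd -` {enat n<..} \<inter> space N \<in> sets N" by (rule measurable_sets[OF U]) simp
    also have "snd -` {enat n<..} \<inter> space N = {\<omega>\<in>space N. enat n < snd \<omega>}" by auto
    finally show ?thesis by (subst mN) simp_all
  qed
qed

lemma fastest_sst_any_space:
  fixes N :: "'v measure" and S :: "'a set"
  assumes "fastest_sst M S \<mu> P \<pi> X T" and "strong_stationary_time N S \<mu> P \<pi> Y U"
  shows "measure M {\<omega>\<in>space M. enat n < T \<omega>} \<le> measure N {\<omega>\<in>space N. enat n < U \<omega>}"
proof -
  note canon = strong_stationary_time_canonical[OF assms(2)]
  have min: "measure M {\<omega>\<in>space M. enat n < T \<omega>} \<le> measure N' {\<omega>\<in>space N'. enat n < U' \<omega>}"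
    if "strong_stationary_time N' S \<mu> P \<pi> Y' U'" for N' :: "((nat \<Rightarrow> 'a) \<times> enat) measure" and Y' U'
    using assms(1) that unfolding fastest_sst_def by blast
  show ?thesis
    using min[OF canon(1)] unfolding canon(2) .
qed

end

theory Submission
  imports Defs
begin

text \<open>The relations between the rates of \<open>P\<close> and those of its classical dual say that \<open>1 / H\<close> is
  harmonic for the dual kernel at the interior states. Such functions exist with \<open>H d = 1\<close> and
  one free parameter; letting that parameter tend to \<open>0\<close>, the rates of \<open>P\<close> tend to
  \<open>p i = qstar i\<close> and \<open>q i = pstar (i - 1)\<close>, whose sum is below \<open>1\<close>. Hence a small
  parameter gives a lazy, reversible, monotone \<open>P\<close>.

  For sharpness, run \<open>X\<close> and the dual in the Diaconis-Fill coupling, in which the conditional law of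
  \<open>X n\<close> given the history of the dual is the row of the link at the current dual state. At absorption
  this row is \<open>\<pi>\<close>, so the absorption time is strong stationary. The entry \<open>d\<close> of every other row
  vanishes, so \<open>prob (X n = d) = prob (absorbed by n) * \<pi> d\<close>, whereas every strong
  stationary time \<open>U\<close> satisfies \<open>prob (U \<le> n) * \<pi> d \<le> prob (X n = d)\<close>.\<close>

section \<open>Markov chains on finite state spaces\<close>

text \<open>Why \<open>1 / H\<close>: solving \<open>qs i = H (i - 1) / H i * p i\<close> and
  \<open>ps i = H (i + 1) / H i * q (i + 1)\<close> for the rates of \<open>P\<close>, and inserting
  them into \<open>rs i = 1 - (p i + q (i + 1))\<close>, gives after division by \<open>H i\<close>
  that row \<open>i\<close> of the dual averages \<open>1 / H\<close> to its value at
  \<open>i\<close>. At state 0 the first relation is void, so the third merely fixes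
  \<open>p 0\<close> and harmonicity is not imposed there; the drop of \<open>1 / H\<close> at 0 is
  the free parameter. As it tends to 0, \<pi> concentrates at 0, and the strict bound on
  \<open>pstar (i - 1) + qstar i\<close> leaves room for positive holding probabilities, hence for
  aperiodicity. Monotonicity comes from \<open>p i + q (i + 1) = 1 - rs i \<le> 1\<close>.

  On a finite state space the conditional expectations in the Markov property reduce to finite sums
  of measures of events, quantified over the events of the filtration. The arguments about chains
  are carried out in this form, in which passing to a smaller filtration or summing out a coordinate
  is elementary.\<close>

abbreviation level :: "'w measure \<Rightarrow> (nat \<Rightarrow> 'w \<Rightarrow> 's) \<Rightarrow> nat \<Rightarrow> 's \<Rightarrow> 'w set" where
  "level M X n s \<equiv> {\<omega> \<in> space M. X n \<omega> = s}"

section \<open>The Markov property as identities between measures of events\<close>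

lemma level_in_sets:
  assumes "X n \<in> N \<rightarrow>\<^sub>M count_space S" "s \<in> S" "space N = space M"
  shows "level M X n s \<in> sets N"
proof -
  have "level M X n s = X n -` {s} \<inter> space N" using assms(3) by auto
  then show ?thesis using measurable_sets[OF assms(1), of "{s}"] assms(2) by simp
qed

lemma (in finite_measure) measure_partition:
  assumes X: "X \<in> M \<rightarrow>\<^sub>M count_space S" and S: "finite S" and A: "A \<in> sets M"
  shows "measure M A = (\<Sum>s\<in>S. measure M (A \<inter> {\<omega> \<in> space M. X \<omega> = s}))"
proof -
  have m: "{\<omega> \<in> space M. X \<omega> = s} \<in> sets M" if "s \<in> S" for s
    using level_in_sets[where X = "\<lambda>_. X" and n = 0, OF X that refl] .
  have "A = (\<Union>s\<in>S. A \<inter> {\<omega> \<in> space M. X \<omega> = s})"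
    using sets.sets_into_space[OF A] measurable_space[OF X] by auto
  moreover have "measure M (\<Union>s\<in>S. A \<inter> {\<omega> \<in> space M. X \<omega> = s})
      = (\<Sum>s\<in>S. measure M (A \<inter> {\<omega> \<in> space M. X \<omega> = s}))"
    using m A by (intro finite_measure_finite_Union S) (auto simp: disjoint_family_on_def)
  ultimately show ?thesis by simp
qed

text \<open>Both sides of the equation are \<open>F\<close>-measurable, so they agree almost
  everywhere iff their integrals agree over every event of \<open>F\<close>. As \<open>X\<close> has
  finitely many values, the integral of \<open>g (X \<omega>)\<close> is a finite sum over level
  sets.\<close>

lemma real_cond_exp_indicator_eq_iff:
  fixes g :: "'s \<Rightarrow> real"
  assumes "prob_space M" and sub: "subalgebra M F" and X: "X \<in> F \<rightarrow>\<^sub>M count_space S"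
    and S: "finite S" and B: "B \<in> sets M"
  shows "(AE \<omega> in M. real_cond_exp M F (indicator B) \<omega> = g (X \<omega>)) \<longleftrightarrow>
    (\<forall>A\<in>sets F. measure M (A \<inter> B) = (\<Sum>s\<in>S. measure M (A \<inter> {\<omega> \<in> space M. X \<omega> = s}) * g s))"
proof -
  interpret prob_space M by fact
  interpret FM: finite_measure_subalgebra M F
    by (simp add: finite_measure_subalgebra_def finite_measure_axioms
        finite_measure_subalgebra_axioms_def sub)
  have XM: "X \<in> M \<rightarrow>\<^sub>M count_space S" using X sub measurable_from_subalg by blast
  have m: "{\<omega> \<in> space M. X \<omega> = s} \<in> sets M" if "s \<in> S" for s
    using level_in_sets[where X = "\<lambda>_. X" and n = 0, OF XM that refl] .
  have gF: "(\<lambda>\<omega>. g (X \<omega>)) \<in> borel_measurable F" by (rule measurable_compose[OF X]) simp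
  have gM[measurable]: "(\<lambda>\<omega>. g (X \<omega>)) \<in> borel_measurable M" by (rule measurable_compose[OF XM]) simp
  have iB: "integrable M (indicator B :: _ \<Rightarrow> real)" using B by (simp add: emeasure_eq_measure)
  have AM: "A \<in> sets M" if "A \<in> sets F" for A using that sub by (auto simp: subalgebra_def)
  have split: "indicator A \<omega> *\<^sub>R g (X \<omega>)
      = (\<Sum>s\<in>S. indicator (A \<inter> {\<omega> \<in> space M. X \<omega> = s}) \<omega> * g s)" if "\<omega> \<in> space M" for A \<omega>
  proof -
    have "X \<omega> \<in> S" using measurable_space[OF XM that] by simp
    then show ?thesis using that S
      by (subst sum.remove[where x = "X \<omega>"]) (auto intro!: sum.neutral simp: indicator_def)
  qed
  have int_g: "(LINT \<omega>:A|M. g (X \<omega>)) = (\<Sum>s\<in>S. measure M (A \<inter> {\<omega> \<in> space M. X \<omega> = s}) * g s)"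
    if "A \<in> sets M" for A
  proof -
    have "(LINT \<omega>:A|M. g (X \<omega>))
        = (LINT \<omega>|M. (\<Sum>s\<in>S. indicator (A \<inter> {\<omega> \<in> space M. X \<omega> = s}) \<omega> * g s))"
      unfolding set_lebesgue_integral_def
      by (rule Bochner_Integration.integral_cong) (simp_all only: split)
    also have "\<dots> = (\<Sum>s\<in>S. measure M (A \<inter> {\<omega> \<in> space M. X \<omega> = s}) * g s)"
      using m that by (subst Bochner_Integration.integral_sum)
        (auto simp: emeasure_eq_measure sets.sets_into_space Int_absorb2 intro!: sum.cong)
    finally show ?thesis .
  qed
  have int_B: "(LINT \<omega>:A|M. indicator B \<omega>) = measure M (A \<inter> B)" if "A \<in> sets M" for A
  proof -
    have "(LINT \<omega>:A|M. (indicator B \<omega> :: real)) = (LINT \<omega>|M. indicator (A \<inter> B) \<omega>)"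
      unfolding set_lebesgue_integral_def
      by (rule Bochner_Integration.integral_cong) (auto simp: indicator_def)
    then show ?thesis using that B by (simp add: sets.sets_into_space Int_absorb2)
  qed
  have ig: "integrable M (\<lambda>\<omega>. g (X \<omega>))"
  proof (rule integrable_const_bound[where B = "Max ((\<lambda>s. \<bar>g s\<bar>) ` S)"])
    show "AE \<omega> in M. norm (g (X \<omega>)) \<le> Max ((\<lambda>s. \<bar>g s\<bar>) ` S)"
      using measurable_space[OF XM] S by (intro AE_I2) auto
  qed simp
  show ?thesis
  proof
    assume ae: "AE \<omega> in M. real_cond_exp M F (indicator B) \<omega> = g (X \<omega>)"
    show "\<forall>A\<in>sets F. measure M (A \<inter> B) = (\<Sum>s\<in>S. measure M (A \<inter> {\<omega> \<in> space M. X \<omega> = s}) * g s)"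
    proof
      fix A assume A: "A \<in> sets F"
      have [measurable]: "A \<in> sets M" using AM A .
      have "measure M (A \<inter> B) = (LINT \<omega>:A|M. real_cond_exp M F (indicator B) \<omega>)"
        using FM.real_cond_exp_intA[OF iB A] int_B[OF AM[OF A]] by simp
      also have "\<dots> = (LINT \<omega>:A|M. g (X \<omega>))"
        unfolding set_lebesgue_integral_def by (rule integral_cong_AE) (use ae in auto)
      finally show "measure M (A \<inter> B) = (\<Sum>s\<in>S. measure M (A \<inter> {\<omega> \<in> space M. X \<omega> = s}) * g s)"
        using int_g[OF AM[OF A]] by simp
    qed
  next
    assume "\<forall>A\<in>sets F. measure M (A \<inter> B) = (\<Sum>s\<in>S. measure M (A \<inter> {\<omega> \<in> space M. X \<omega> = s}) * g s)"
    then show "AE \<omega> in M. real_cond_exp M F (indicator B) \<omega> = g (X \<omega>)"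
      by (intro FM.real_cond_exp_charact iB ig gF) (simp add: int_g int_B AM)
  qed
qed

lemma markov_wrt_iff:
  assumes S: "finite S"
  shows "markov_wrt M F S \<mu> P X \<longleftrightarrow>
    prob_space M \<and> filtration (space M) F \<and> (\<forall>n. subalgebra M (F n)) \<and>
    (\<forall>n. X n \<in> F n \<rightarrow>\<^sub>M count_space S) \<and> (\<forall>s\<in>S. measure M (level M X 0 s) = \<mu> s) \<and>
    (\<forall>n. \<forall>t\<in>S. \<forall>A\<in>sets (F n). measure M (A \<inter> level M X (Suc n) t)
       = (\<Sum>s\<in>S. measure M (A \<inter> level M X n s) * P s t))"
proof -
  have "(AE \<omega> in M. real_cond_exp M (F n) (indicator (level M X (Suc n) t)) \<omega> = P (X n \<omega>) t) \<longleftrightarrow>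
      (\<forall>A\<in>sets (F n). measure M (A \<inter> level M X (Suc n) t)
        = (\<Sum>s\<in>S. measure M (A \<inter> level M X n s) * P s t))"
    if "prob_space M" "\<forall>n. subalgebra M (F n)" "\<forall>n. X n \<in> F n \<rightarrow>\<^sub>M count_space S" "t \<in> S" for n t
  proof (rule real_cond_exp_indicator_eq_iff)
    have "X (Suc n) \<in> M \<rightarrow>\<^sub>M count_space S" using that measurable_from_subalg by blast
    then show "level M X (Suc n) t \<in> sets M" using that(4) by (rule level_in_sets) simp
  qed (use that S in auto)
  then show ?thesis unfolding markov_wrt_def by blast
qed

section \<open>Natural filtrations\<close>

lemma natural_filtration_space: "space (natural_filtration M S X n) = space M"
  unfolding natural_filtration_def by (rule space_measure_of) auto

lemma natural_filtration_sets:
  "sets (natural_filtration M S X n)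
    = sigma_sets (space M) {X i -` A \<inter> space M | i A. i \<le> n \<and> A \<subseteq> S}"
  unfolding natural_filtration_def by (rule sets_measure_of) auto

lemma natural_filtration_least:
  assumes "\<And>i. i \<le> n \<Longrightarrow> X i \<in> G \<rightarrow>\<^sub>M count_space S" "space G = space M"
  shows "sets (natural_filtration M S X n) \<subseteq> sets G"
  unfolding natural_filtration_sets assms(2)[symmetric]
proof (rule sets.sigma_sets_subset, clarify)
  fix i A assume "i \<le> n" "A \<subseteq> S"
  then show "X i -` A \<inter> space G \<in> sets G" using measurable_sets[OF assms(1), of i A] by simp
qed

lemma natural_filtration_adapted:
  assumes "\<And>\<omega>. \<omega> \<in> space M \<Longrightarrow> X i \<omega> \<in> S" "i \<le> n"
  shows "X i \<in> natural_filtration M S X n \<rightarrow>\<^sub>M count_space S"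
proof (rule measurableI)
  fix A assume "A \<in> sets (count_space S)"
  then show "X i -` A \<inter> space (natural_filtration M S X n) \<in> sets (natural_filtration M S X n)"
    unfolding natural_filtration_space natural_filtration_sets using assms(2)
    by (intro sigma_sets.Basic) auto
qed (use assms in \<open>simp add: natural_filtration_space\<close>)

lemma natural_filtration_mono:
  "m \<le> n \<Longrightarrow> sets (natural_filtration M S X m) \<subseteq> sets (natural_filtration M S X n)"
  unfolding natural_filtration_sets by (rule sigma_sets_mono') (auto intro: le_trans)

lemma natural_filtration_filtration: "filtration (space M) (natural_filtration M S X)"
  by standard (simp_all add: natural_filtration_space natural_filtration_mono)

lemma natural_filtration_subalgebra:
  assumes "\<And>n. X n \<in> M \<rightarrow>\<^sub>M count_space S"
  shows "subalgebra M (natural_filtration M S X n)"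
  using natural_filtration_least[where G = M, OF assms]
  by (simp add: subalgebra_def natural_filtration_space)

text \<open>Fixing the value of \<open>X (Suc n)\<close> trivializes the last coordinate: a
  generator that looks at it becomes the whole space or the empty set. The claim then passes through
  complements and countable unions. In an induction on time it replaces an event of the history up
  to \<open>Suc n\<close> by one up to \<open>n\<close>.\<close>

lemma natural_filtration_Suc_decompose:
  assumes "A \<in> sets (natural_filtration M S X (Suc n))"
  shows "\<exists>A'\<in>sets (natural_filtration M S X n).
           A \<inter> level M X (Suc n) s = A' \<inter> level M X (Suc n) s"
  using assms unfolding natural_filtration_sets
proof (induction rule: sigma_sets.induct)
  case (Basic a)
  then obtain i B where i: "i \<le> Suc n" and B: "B \<subseteq> S" and a: "a = X i -` B \<inter> space M" by blast
  show ?case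
  proof (cases "i \<le> n")
    case True
    then show ?thesis using B a by (intro bexI[of _ a] sigma_sets.Basic) auto
  next
    case False
    then have [simp]: "i = Suc n" using i by simp
    show ?thesis
    proof (cases "s \<in> B")
      case True
      then show ?thesis using a by (intro bexI[of _ "space M"] sigma_sets_top) auto
    next
      case False
      then show ?thesis using a by (intro bexI[of _ "{}"] sigma_sets.Empty) auto
    qed
  qed
next
  case Empty
  show ?case by (intro bexI[of _ "{}"] sigma_sets.Empty) simp
next
  case (Compl a)
  then obtain A' where "A' \<in> sigma_sets (space M) {X i -` A \<inter> space M |i A. i \<le> n \<and> A \<subseteq> S}"
    "a \<inter> level M X (Suc n) s = A' \<inter> level M X (Suc n) s" by blast
  then show ?case by (intro bexI[of _ "space M - A'"] sigma_sets.Compl) auto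
next
  case (Union a)
  then have "\<forall>j. \<exists>A'. A' \<in> sigma_sets (space M) {X i -` A \<inter> space M |i A. i \<le> n \<and> A \<subseteq> S}
      \<and> a j \<inter> level M X (Suc n) s = A' \<inter> level M X (Suc n) s" by blast
  then obtain A' where A': "\<forall>j. A' j \<in> sigma_sets (space M) {X i -` A \<inter> space M |i A. i \<le> n \<and> A \<subseteq> S}
      \<and> a j \<inter> level M X (Suc n) s = A' j \<inter> level M X (Suc n) s" by (rule choice[THEN exE])
  show ?case
  proof (rule bexI)
    have "(\<Union>j. a j) \<inter> level M X (Suc n) s = (\<Union>j. a j \<inter> level M X (Suc n) s)" by blast
    also have "\<dots> = (\<Union>j. A' j \<inter> level M X (Suc n) s)" using A' by simp
    also have "\<dots> = (\<Union>j. A' j) \<inter> level M X (Suc n) s" by blast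
    finally show "(\<Union>j. a j) \<inter> level M X (Suc n) s = (\<Union>j. A' j) \<inter> level M X (Suc n) s" .
    show "(\<Union>j. A' j) \<in> sigma_sets (space M) {X i -` A \<inter> space M |i A. i \<le> n \<and> A \<subseteq> S}"
      using A' by (intro sigma_sets.Union) blast
  qed
qed

lemma markov_chainI:
  assumes S: "finite S" and M: "prob_space M" and XM: "\<And>n. X n \<in> M \<rightarrow>\<^sub>M count_space S"
    and init: "\<And>s. s \<in> S \<Longrightarrow> measure M (level M X 0 s) = \<mu> s"
    and step: "\<And>n t A. t \<in> S \<Longrightarrow> A \<in> sets (natural_filtration M S X n) \<Longrightarrow>
      measure M (A \<inter> level M X (Suc n) t) = (\<Sum>s\<in>S. measure M (A \<inter> level M X n s) * P s t)"
  shows "markov_chain M S \<mu> P X"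
  unfolding markov_chain_def markov_wrt_iff[OF S]
proof (intro conjI allI ballI)
  show "X n \<in> natural_filtration M S X n \<rightarrow>\<^sub>M count_space S" for n
    using measurable_space[OF XM] by (intro natural_filtration_adapted) auto
qed (simp_all add: M init step natural_filtration_filtration natural_filtration_subalgebra[OF XM])

text \<open>The step identity is quantified over events, so a smaller filtration inherits it, and
  the natural filtration is the smallest one to which \<open>X\<close> is adapted.\<close>

lemma markov_wrt_imp_markov_chain:
  assumes S: "finite S" and mk: "markov_wrt M F S \<mu> P X"
  shows "markov_chain M S \<mu> P X"
proof -
  note F = mk[unfolded markov_wrt_iff[OF S]]
  have XM: "X n \<in> M \<rightarrow>\<^sub>M count_space S" for n using F measurable_from_subalg by blast
  have spF: "space (F n) = space M" for n using F by (auto simp: subalgebra_def)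
  have ad: "X i \<in> F n \<rightarrow>\<^sub>M count_space S" if "i \<le> n" for i n
  proof (rule measurableI)
    fix A assume A: "A \<in> sets (count_space S)"
    have "X i -` A \<inter> space (F i) \<in> sets (F i)" using F A measurable_sets by blast
    moreover have "sets (F i) \<subseteq> sets (F n)"
      using F that filtration.sets_F_mono by blast
    ultimately show "X i -` A \<inter> space (F n) \<in> sets (F n)" using spF by auto
  qed (use measurable_space[OF XM] spF in auto)
  have sub: "sets (natural_filtration M S X n) \<subseteq> sets (F n)" for n
    by (rule natural_filtration_least[OF ad spF])
  show ?thesis
  proof (rule markov_chainI[OF S _ XM])
    fix n t A assume "t \<in> S" "A \<in> sets (natural_filtration M S X n)"
    then show "measure M (A \<inter> level M X (Suc n) t)
        = (\<Sum>s\<in>S. measure M (A \<inter> level M X n s) * P s t)"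
      using F sub[of n] by blast
  qed (use F in simp_all)
qed

section \<open>Existence of a chain with a given kernel, by the Ionescu-Tulcea theorem\<close>

lemma markov_chain_exists:
  fixes S :: "'s set" and Q :: "'s \<Rightarrow> 's \<Rightarrow> real"
  assumes S: "finite S" and Q: "stochastic_on S Q"
    and \<mu>: "\<And>s. s \<in> S \<Longrightarrow> 0 \<le> \<mu> s" "(\<Sum>s\<in>S. \<mu> s) = 1"
  shows "\<exists>M :: (nat \<Rightarrow> 's) measure. markov_chain M S \<mu> Q (\<lambda>n \<omega>. \<omega> n)"
proof -
  define N where "N = (\<lambda>_::nat. count_space S)"
  have N_app: "N i = count_space S" for i by (simp add: N_def)
  \<comment> \<open>\<open>K i\<close> draws coordinate \<open>i\<close> given the prefix on
    \<open>{0..<i}\<close>: from the initial law if \<open>i = 0\<close>, otherwise from the row of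
    \<open>Q\<close> at the last coordinate \<open>i - 1\<close>.\<close>
  define K where "K i \<omega> = point_measure S (\<lambda>s. ennreal (case i of 0 \<Rightarrow> \<mu> s | Suc n \<Rightarrow> Q (\<omega> n) s))"
    for i and \<omega> :: "nat \<Rightarrow> 's"
  have pm: "prob_space (point_measure S (\<lambda>s. ennreal (f s)))"
    if "\<And>s. s \<in> S \<Longrightarrow> 0 \<le> f s" "(\<Sum>s\<in>S. f s) = 1" for f
    by (rule prob_space_point_measure) (use that S in \<open>auto simp: sum_ennreal\<close>)
  have pQ: "prob_space (point_measure S (\<lambda>t. ennreal (Q s t)))" if "s \<in> S" for s
    using Q that by (intro pm) (auto simp: stochastic_on_def)
  have p\<mu>: "prob_space (point_measure S (\<lambda>s. ennreal (\<mu> s)))" using \<mu> by (intro pm)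
  have sub: "point_measure S f \<in> space (subprob_algebra (count_space S))"
    if "prob_space (point_measure S f)" for f
    using that by (simp add: space_subprob_algebra sets_point_measure prob_space_imp_subprob_space)
  have K_meas: "K i \<in> PiM {0..<i} N \<rightarrow>\<^sub>M subprob_algebra (N i)" for i
  proof (cases i)
    case 0
    then have "K i = (\<lambda>_. point_measure S (\<lambda>s. ennreal (\<mu> s)))" by (simp add: K_def fun_eq_iff)
    then show ?thesis using sub[OF p\<mu>] by (simp add: N_def)
  next
    case (Suc n)
    have "(\<lambda>s. point_measure S (\<lambda>t. ennreal (Q s t))) \<in> count_space S \<rightarrow>\<^sub>M subprob_algebra (N i)"
      using sub[OF pQ] by (simp add: N_def)
    moreover have "(\<lambda>\<omega>. \<omega> n) \<in> PiM {0..<i} N \<rightarrow>\<^sub>M count_space S"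
      using measurable_component_singleton[of n "{0..<i}" N] Suc by (simp add: N_def)
    ultimately have "(\<lambda>\<omega>. point_measure S (\<lambda>t. ennreal (Q (\<omega> n) t)))
        \<in> PiM {0..<i} N \<rightarrow>\<^sub>M subprob_algebra (N i)"
      by (rule measurable_compose[rotated])
    then show ?thesis using Suc by (simp add: K_def[abs_def])
  qed
  interpret IT: Ionescu_Tulcea K N
  proof (rule Ionescu_Tulcea.intro)
    fix i :: nat and x :: "nat \<Rightarrow> 's" assume x: "x \<in> space (PiM {0..<i} N)"
    then have "x n \<in> S" if "i = Suc n" for n using that by (auto simp: space_PiM N_app PiE_iff)
    then show "prob_space (K i x)" using p\<mu> pQ by (cases i) (auto simp: K_def)
  qed (rule K_meas)
  let ?M = "IT.PF.lim" and ?C = "\<lambda>n. IT.C 0 n (\<lambda>_. undefined)"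
  have u: "(\<lambda>_. undefined) \<in> space (PiM {0..<0} N)" by (simp add: space_PiM)
  have stC: "sets (?C n) = sets (PiM {0..<n} N)" and spC: "space (?C n) = space (PiM {0..<n} N)" for n
    using IT.sets_C[OF u, of n] IT.space_C[OF u, of n] by simp_all
  \<comment> \<open>\<open>?C n\<close> is the law of the first \<open>n\<close> coordinates, so the
    measure of an event determined by a prefix can be computed there instead of on the infinite
    product.\<close>
  have emb: "emeasure ?M {\<omega> \<in> space ?M. restrict \<omega> {0..<n} \<in> A} = emeasure (?C n) A"
    if A: "A \<in> sets (PiM {0..<n} N)" for n A
  proof -
    have "{\<omega> \<in> space ?M. restrict \<omega> {0..<n} \<in> A} = IT.PF.emb UNIV {0..<n} A"
      by (auto simp: prod_emb_def space_PiM N_app)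
    then have "emeasure ?M {\<omega> \<in> space ?M. restrict \<omega> {0..<n} \<in> A} = emeasure (IT.CI {0..<n}) A"
      using IT.lim[OF _ A] by simp
    also have "\<dots> = emeasure (?C n) (IT.PF.emb {0..<n} {0..<n} A)"
      by (rule IT.emeasure_CI) (use A in auto)
    also have "IT.PF.emb {0..<n} {0..<n} A = A"
      using sets.sets_into_space[OF A] by (intro prod_emb_id) (simp add: space_PiM)
    finally show ?thesis .
  qed
  have res: "restrict \<omega> {0..<n} \<in> space (PiM {0..<n} N)" if "\<omega> \<in> space ?M" for \<omega> n
    using that by (auto simp: space_PiM N_app)
  have prob: "prob_space ?M"
  proof
    have "emeasure ?M (space ?M)
        = emeasure ?M {\<omega> \<in> space ?M. restrict \<omega> {0..<0} \<in> space (PiM {0..<0} N)}"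
      using res[of _ 0] by (intro arg_cong[of _ _ "emeasure ?M"]) blast
    also have "\<dots> = 1"
      using emb[of "space (PiM {0..<0} N)" 0] prob_space.emeasure_space_1[OF IT.prob_space_C[OF u, of 0]]
      by (simp add: spC)
    finally show "emeasure ?M (space ?M) = 1" .
  qed
  interpret M: prob_space ?M by (rule prob)
  define X where "X = (\<lambda>n (\<omega> :: nat \<Rightarrow> 's). \<omega> n)"
  have XM: "X n \<in> ?M \<rightarrow>\<^sub>M count_space S" for n
    using measurable_component_singleton[of n UNIV N]
    by (simp add: X_def N_app measurable_cong_sets[OF IT.PF.sets_lim refl])
  have XC: "(\<lambda>x. x n) \<in> PiM {0..<Suc n} N \<rightarrow>\<^sub>M count_space S" for n
    using measurable_component_singleton[of n "{0..<Suc n}" N] by (simp add: N_app)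
  have XCset: "{x \<in> space (PiM {0..<Suc n} N). x n = s} \<in> sets (PiM {0..<Suc n} N)" if "s \<in> S" for n s
    using level_in_sets[where X = "\<lambda>n x. x n", OF XC that refl] .
  \<comment> \<open>The history up to time \<open>n\<close> consists of \<open>Suc n\<close>
    coordinates, so its events are cylinders over \<open>{0..<Suc n}\<close>.\<close>
  have nat_set: "\<exists>A'\<in>sets (PiM {0..<Suc n} N). A = {\<omega> \<in> space ?M. restrict \<omega> {0..<Suc n} \<in> A'}"
    if A: "A \<in> sets (natural_filtration ?M S X n)" for n A
  proof -
    let ?r = "\<lambda>\<omega>. restrict \<omega> {0..<Suc n}"
    let ?V = "vimage_algebra (space ?M) ?r (PiM {0..<Suc n} N)"
    have r: "?r \<in> space ?M \<rightarrow> space (PiM {0..<Suc n} N)" using res[of _ "Suc n"] by blast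
    have "sets (natural_filtration ?M S X n) \<subseteq> sets ?V"
    proof (rule natural_filtration_least)
      fix i assume i: "i \<le> n"
      have "(\<lambda>\<omega>. ?r \<omega> i) \<in> ?V \<rightarrow>\<^sub>M count_space S"
        using measurable_compose[OF measurable_vimage_algebra1[OF r]
            measurable_component_singleton[of i "{0..<Suc n}" N]] i
        by (simp add: N_app)
      then show "X i \<in> ?V \<rightarrow>\<^sub>M count_space S" using i by (simp add: X_def)
    qed simp
    then have "A \<in> sets ?V" using A by blast
    then obtain A' where "A' \<in> sets (PiM {0..<Suc n} N)" "A = ?r -` A' \<inter> space ?M"
      unfolding sets_vimage_algebra2[OF r] by blast
    then show ?thesis by (intro bexI[of _ A']) auto
  qed
  have init: "measure ?M (level ?M X 0 s) = \<mu> s" if s: "s \<in> S" for s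
  proof -
    let ?B = "{x \<in> space (PiM {0..<Suc 0} N). x 0 = s}"
    have "level ?M X 0 s = {\<omega> \<in> space ?M. restrict \<omega> {0..<Suc 0} \<in> ?B}"
      using res[of _ "Suc 0"] by (auto simp: X_def)
    then have "emeasure ?M (level ?M X 0 s) = emeasure (?C (Suc 0)) ?B"
      using emb[OF XCset[OF s]] by (simp only:)
    also have "\<dots> = emeasure (IT.eP 0 (\<lambda>_. undefined)) ?B"
      by (simp only: IT.C.simps add_0 bind_return[OF IT.measurable_eP[of 0] u])
    also have "\<dots> = emeasure (K 0 (\<lambda>_. undefined)) ((\<lambda>x. (\<lambda>_. undefined)(0 := x)) -` ?B \<inter> space (N 0))"
      by (rule IT.emeasure_eP[OF u XCset[OF s]])
    also have "(\<lambda>x. (\<lambda>_. undefined)(0 := x)) -` ?B \<inter> space (N 0) = {s}"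
      using s by (auto simp: space_PiM N_app PiE_iff extensional_def)
    also have "emeasure (K 0 (\<lambda>_. undefined)) {s} = ennreal (\<mu> s)"
      using s S by (simp add: K_def emeasure_point_measure_finite)
    finally show ?thesis using \<mu>(1)[OF s] by (simp add: measure_def)
  qed
  have step: "measure ?M (A \<inter> level ?M X (Suc n) t)
      = (\<Sum>s\<in>S. measure ?M (A \<inter> level ?M X n s) * Q s t)"
    if t: "t \<in> S" and A: "A \<in> sets (natural_filtration ?M S X n)" for n t A
  proof -
    obtain A' where A': "A' \<in> sets (PiM {0..<Suc n} N)"
      and AA': "A = {\<omega> \<in> space ?M. restrict \<omega> {0..<Suc n} \<in> A'}"
      using nat_set[OF A] by blast
    let ?I = "{0..<Suc n}" and ?J = "{0..<Suc (Suc n)}"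
    let ?B = "{x \<in> space (PiM ?J N). restrict x ?I \<in> A' \<and> x (Suc n) = t}"
    let ?A = "\<lambda>s. {x \<in> A'. x n = s}"
    have As: "?A s \<in> sets (PiM ?I N)" if "s \<in> S" for s
    proof -
      have "?A s = A' \<inter> {x \<in> space (PiM ?I N). x n = s}" using sets.sets_into_space[OF A'] by auto
      then show ?thesis using A' XCset[OF that, of n] by simp
    qed
    have B: "?B \<in> sets (PiM ?J N)"
    proof -
      have "(\<lambda>x. restrict x ?I) \<in> PiM ?J N \<rightarrow>\<^sub>M PiM ?I N" by (rule measurable_restrict_subset) auto
      then have "(\<lambda>x. restrict x ?I) -` A' \<inter> space (PiM ?J N) \<in> sets (PiM ?J N)"
        using A' by (rule measurable_sets)
      moreover have "?B = ((\<lambda>x. restrict x ?I) -` A' \<inter> space (PiM ?J N))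
          \<inter> {x \<in> space (PiM ?J N). x (Suc n) = t}" by auto
      ultimately show ?thesis using XCset[OF t, of "Suc n"] by simp
    qed
    have Q0: "0 \<le> Q s t" if "s \<in> S" for s using Q that t by (simp add: stochastic_on_def)
    have levels: "A \<inter> level ?M X n s = {\<omega> \<in> space ?M. restrict \<omega> ?I \<in> ?A s}" for s
      by (auto simp: AA' X_def)
    \<comment> \<open>The mass given to \<open>?B\<close> depends on the prefix only through
      membership in \<open>A'\<close> and the last state \<open>x n\<close>. Splitting by that state
      turns the integrand into a finite combination of indicators.\<close>
    have kern: "emeasure (IT.eP (Suc n) x) ?B = (\<Sum>s\<in>S. ennreal (Q s t) * indicator (?A s) x)"
      if x: "x \<in> space (PiM ?I N)" for x
    proof -
      have xS: "x n \<in> S" using x by (auto simp: space_PiM N_app PiE_iff)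
      have rx: "restrict (x(Suc n := y)) ?I = x" for y
        using x by (auto simp: space_PiM PiE_iff extensional_def fun_eq_iff restrict_def)
      have upd: "x(Suc n := t) \<in> space (PiM ?J N)"
        using x t by (auto simp: space_PiM N_app PiE_iff extensional_def less_Suc_eq)
      have "(\<lambda>y. x(Suc n := y)) -` ?B \<inter> space (N (Suc n)) = (if x \<in> A' then {t} else {})"
        using upd t by (auto simp: rx N_app)
      then have "emeasure (IT.eP (Suc n) x) ?B = emeasure (K (Suc n) x) (if x \<in> A' then {t} else {})"
        using IT.emeasure_eP[OF x B] by simp
      also have "\<dots> = ennreal (Q (x n) t) * indicator A' x"
        using t S by (simp add: K_def emeasure_point_measure_finite)
      also have "\<dots> = (\<Sum>s\<in>S. ennreal (Q s t) * indicator (?A s) x)"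
        using S xS by (subst sum.remove[where x = "x n"]) (auto intro!: sum.neutral simp: indicator_def)
      finally show ?thesis .
    qed
    have "A \<inter> level ?M X (Suc n) t = {\<omega> \<in> space ?M. restrict \<omega> ?J \<in> ?B}"
    proof -
      have "restrict (restrict \<omega> ?J) ?I = restrict \<omega> ?I" for \<omega> :: "nat \<Rightarrow> 's"
        by (auto simp: fun_eq_iff)
      then show ?thesis using res[of _ "Suc (Suc n)"] by (auto simp: AA' X_def)
    qed
    then have "emeasure ?M (A \<inter> level ?M X (Suc n) t) = emeasure (?C (Suc (Suc n))) ?B"
      using emb[OF B] by (simp only:)
    also have "\<dots> = (\<integral>\<^sup>+x. emeasure (IT.eP (Suc n) x) ?B \<partial>?C (Suc n))"
    proof -
      have ne: "space (?C (Suc n)) \<noteq> {}"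
        using IT.prob_space_C[OF u, of "Suc n"] by (rule prob_space.not_empty)
      have eP: "IT.eP (Suc n) \<in> ?C (Suc n) \<rightarrow>\<^sub>M subprob_algebra (PiM ?J N)"
        using IT.measurable_eP[of "Suc n"] by (simp only: measurable_cong_sets[OF stC refl])
      have "?C (Suc (Suc n)) = ?C (Suc n) \<bind> IT.eP (Suc n)" by (simp only: IT.C.simps add_0)
      then show ?thesis using emeasure_bind[OF ne eP B] by (simp only:)
    qed
    also have "\<dots> = (\<integral>\<^sup>+x. (\<Sum>s\<in>S. ennreal (Q s t) * indicator (?A s) x) \<partial>?C (Suc n))"
      by (rule nn_integral_cong) (rule kern, simp add: spC del: IT.C.simps)
    also have "\<dots> = (\<Sum>s\<in>S. ennreal (Q s t) * emeasure (?C (Suc n)) (?A s))"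
    proof -
      have AsC: "?A s \<in> sets (?C (Suc n))" if "s \<in> S" for s using As[OF that] stC by blast
      show ?thesis
        by (subst nn_integral_sum)
          (auto simp: nn_integral_cmult_indicator[OF AsC] simp del: IT.C.simps
            intro!: sum.cong borel_measurable_times_ennreal borel_measurable_indicator AsC)
    qed
    also have "\<dots> = (\<Sum>s\<in>S. ennreal (measure ?M (A \<inter> level ?M X n s) * Q s t))"
    proof (rule sum.cong[OF refl])
      fix s assume s: "s \<in> S"
      have "emeasure (?C (Suc n)) (?A s) = ennreal (measure ?M (A \<inter> level ?M X n s))"
        using emb[OF As[OF s]] by (simp only: levels M.emeasure_eq_measure)
      then show "ennreal (Q s t) * emeasure (?C (Suc n)) (?A s)
          = ennreal (measure ?M (A \<inter> level ?M X n s) * Q s t)"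
        using Q0[OF s] by (simp only: ennreal_mult measure_nonneg mult.commute)
    qed
    also have "\<dots> = ennreal (\<Sum>s\<in>S. measure ?M (A \<inter> level ?M X n s) * Q s t)"
      using Q0 by (intro sum_ennreal) simp
    finally show ?thesis
      using Q0 by (simp add: M.emeasure_eq_measure sum_nonneg)
  qed
  have "markov_chain ?M S \<mu> Q X"
    by (rule markov_chainI[OF S prob XM init step])
  then show ?thesis unfolding X_def by blast
qed

section \<open>Laws at a fixed time, and the law at a strong stationary time\<close>

lemma markov_wrt_law_Suc:
  assumes S: "finite S" and mk: "markov_wrt M F S \<mu> P X" and t: "t \<in> S"
  shows "measure M (level M X (Suc n) t) = (\<Sum>s\<in>S. measure M (level M X n s) * P s t)"
proof -
  note F = mk[unfolded markov_wrt_iff[OF S]]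
  have "space M \<in> sets (F n)" using F sets.top[of "F n"] by (auto simp: subalgebra_def)
  then have "measure M (space M \<inter> level M X (Suc n) t)
      = (\<Sum>s\<in>S. measure M (space M \<inter> level M X n s) * P s t)"
    using F t by blast
  moreover have "space M \<inter> level M X k s = level M X k s" for k s by auto
  ultimately show ?thesis by (simp only:)
qed

text \<open>Competing strong stationary times live on another sample space; this identifies the law
  of their chain at time \<open>n\<close> with that of \<open>X n\<close>.\<close>

lemma markov_wrt_law_unique:
  assumes S: "finite S" and "markov_wrt M F S \<mu> P X" "markov_wrt N G S \<mu> P Y" and "s \<in> S"
  shows "measure M (level M X n s) = measure N (level N Y n s)"
  using assms(4)
proof (induction n arbitrary: s)
  case 0
  then show ?case using assms(2,3) by (simp add: markov_wrt_def)
next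
  case (Suc n)
  then show ?case
    by (simp only: markov_wrt_law_Suc[OF S assms(2)] markov_wrt_law_Suc[OF S assms(3)] cong: sum.cong)
qed

lemma markov_wrt_law_power:
  assumes mk: "markov_wrt M F {..d} (\<lambda>s. of_bool (s = 0)) P X" and j: "j \<le> d"
  shows "measure M (level M X n j) = kernel_power d P n 0 j"
proof -
  \<comment> \<open>Powers grow by a factor on the left, whereas the law evolves by a factor on the
    right. Trading one factor of the power for one unit of time reconciles the two, which is why
    \<open>m\<close> is arbitrary in the induction.\<close>
  have shift: "(\<Sum>i\<le>d. measure M (level M X m i) * kernel_power d P n i j) = measure M (level M X (m + n) j)"
    for m
  proof (induction n arbitrary: m)
    case 0
    then show ?case using j by simp
  next
    case (Suc n)
    have "(\<Sum>i\<le>d. measure M (level M X m i) * kernel_power d P (Suc n) i j)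
        = (\<Sum>i\<le>d. \<Sum>k\<le>d. measure M (level M X m i) * P i k * kernel_power d P n k j)"
      by (simp add: kernel_mult_def sum_distrib_left mult.assoc)
    also have "\<dots> = (\<Sum>k\<le>d. \<Sum>i\<le>d. measure M (level M X m i) * P i k * kernel_power d P n k j)"
      by (rule sum.swap)
    also have "\<dots> = (\<Sum>k\<le>d. measure M (level M X (Suc m) k) * kernel_power d P n k j)"
    proof (rule sum.cong[OF refl])
      fix k assume k: "k \<in> {..d}"
      show "(\<Sum>i\<le>d. measure M (level M X m i) * P i k * kernel_power d P n k j)
          = measure M (level M X (Suc m) k) * kernel_power d P n k j"
        unfolding markov_wrt_law_Suc[OF finite_atMost mk k]
        by (rule sum_distrib_right[symmetric])
    qed
    also have "\<dots> = measure M (level M X (m + Suc n) j)" using Suc[of "Suc m"] by simp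
    finally show ?case .
  qed
  have "measure M (level M X n j) = (\<Sum>i\<le>d. measure M (level M X 0 i) * kernel_power d P n i j)"
    using shift[of 0] by simp
  also have "\<dots> = (\<Sum>i\<le>d. of_bool (i = 0) * kernel_power d P n i j)"
    using mk by (intro sum.cong) (auto simp: markov_wrt_def)
  finally show ?thesis by simp
qed

text \<open>Once \<open>U\<close> has occurred the chain stays stationary. In the induction,
  \<open>U \<le> n + 1\<close> splits into \<open>U \<le> n\<close>, an event of \<open>F n\<close>
  on which one step of \<open>P\<close> preserves \<pi>, and \<open>U = n + 1\<close>, on which
  \<pi> appears by independence of the stopped state and \<open>U\<close>.\<close>

lemma strong_stationary_time_stopped_law:
  assumes S: "finite S" and sst: "strong_stationary_time N S \<mu> P \<pi> Y U"
    and stat: "\<And>t. t \<in> S \<Longrightarrow> (\<Sum>s\<in>S. \<pi> s * P s t) = \<pi> t" and y: "y \<in> S"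
  shows "measure N ({\<omega> \<in> space N. U \<omega> \<le> enat n} \<inter> level N Y n y)
    = measure N {\<omega> \<in> space N. U \<omega> \<le> enat n} * \<pi> y"
proof -
  obtain F where mk: "markov_wrt N F S \<mu> P Y"
    and stop: "\<And>n. {\<omega> \<in> space N. U \<omega> \<le> enat n} \<in> sets (F n)"
    using sst unfolding strong_stationary_time_def by blast
  note F = mk[unfolded markov_wrt_iff[OF S]]
  interpret prob_space N using F by blast
  have stF: "sets (F n) \<subseteq> sets N" for n using F by (auto simp: subalgebra_def)
  have YN: "Y n \<in> N \<rightarrow>\<^sub>M count_space S" for n using F measurable_from_subalg by blast
  have Yl: "level N Y n s \<in> sets N" if "s \<in> S" for n s using level_in_sets[OF YN that refl] .
  let ?le = "\<lambda>n. {\<omega> \<in> space N. U \<omega> \<le> enat n}" and ?eq = "\<lambda>n. {\<omega> \<in> space N. U \<omega> = enat n}"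
  have le: "?le n \<in> sets N" for n using stop stF by blast
  have ind: "indep_set {(\<lambda>\<omega>. Y (the_enat (U \<omega>)) \<omega>) -` A \<inter> space N | A. A \<subseteq> S} {U -` B \<inter> space N | B. B \<subseteq> UNIV}"
    and law: "\<And>s. s \<in> S \<Longrightarrow> measure N {\<omega> \<in> space N. Y (the_enat (U \<omega>)) \<omega> = s} = \<pi> s"
    using sst unfolding strong_stationary_time_def by blast+
  have eqN: "?eq n \<in> sets N" for n
  proof -
    have "?eq n = U -` {enat n} \<inter> space N" by auto
    then show ?thesis using ind unfolding indep_sets2_eq by blast
  qed
  have eq: "measure N (?eq n \<inter> level N Y n s) = measure N (?eq n) * \<pi> s" if s: "s \<in> S" for n s
  proof -
    let ?a = "(\<lambda>\<omega>. Y (the_enat (U \<omega>)) \<omega>) -` {s} \<inter> space N" and ?b = "U -` {enat n} \<inter> space N"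
    have "measure N (?a \<inter> ?b) = measure N ?a * measure N ?b"
      using ind s unfolding indep_sets2_eq by blast
    moreover have "?a \<inter> ?b = ?eq n \<inter> level N Y n s" "?b = ?eq n"
      "?a = {\<omega> \<in> space N. Y (the_enat (U \<omega>)) \<omega> = s}" by auto
    ultimately show ?thesis using law[OF s] by simp
  qed
  show ?thesis
    using y
  proof (induction n arbitrary: y)
    case 0
    have "?le 0 = ?eq 0" by (auto simp: enat_0)
    then show ?case using eq[OF 0, of 0] by (simp only:)
  next
    case (Suc n)
    have split: "?le (Suc n) = ?le n \<union> ?eq (Suc n)"
    proof -
      have "t \<le> enat (Suc n) \<longleftrightarrow> t \<le> enat n \<or> t = enat (Suc n)" for t by (cases t) auto
      then show ?thesis by auto
    qed
    have disj: "?le n \<inter> ?eq (Suc n) = {}" by auto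
    have "measure N (?le n \<inter> level N Y (Suc n) y) = (\<Sum>s\<in>S. measure N (?le n \<inter> level N Y n s) * P s y)"
      using F Suc.prems stop by blast
    also have "\<dots> = (\<Sum>s\<in>S. measure N (?le n) * (\<pi> s * P s y))"
      by (rule sum.cong[OF refl]) (simp add: Suc.IH)
    also have "\<dots> = measure N (?le n) * \<pi> y" by (simp add: stat[OF Suc.prems] flip: sum_distrib_left)
    finally have old: "measure N (?le n \<inter> level N Y (Suc n) y) = measure N (?le n) * \<pi> y" .
    have "measure N (?le (Suc n) \<inter> level N Y (Suc n) y)
        = measure N (?le n \<inter> level N Y (Suc n) y) + measure N (?eq (Suc n) \<inter> level N Y (Suc n) y)"
      unfolding split Int_Un_distrib2 using le eqN Yl[OF Suc.prems] disj
      by (intro finite_measure_Union) auto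
    also have "\<dots> = (measure N (?le n) + measure N (?eq (Suc n))) * \<pi> y"
      using old eq[OF Suc.prems] by (simp add: distrib_right)
    also have "measure N (?le n) + measure N (?eq (Suc n)) = measure N (?le (Suc n))"
      unfolding split using le eqN disj by (intro finite_measure_Union[symmetric]) auto
    finally show ?case .
  qed
qed

section \<open>Absorption times as first hitting times\<close>

lemma absorption_time_le_iff: "absorption_time d X \<omega> \<le> enat n \<longleftrightarrow> (\<exists>m\<le>n. X m \<omega> = d)"
proof
  assume le: "absorption_time d X \<omega> \<le> enat n"
  \<comment> \<open>The infimum of the empty set is \<open>\<infinity>\<close>, so some hitting time
    exists, and a nonempty set of times contains its infimum.\<close>
  then have "enat ` {n. X n \<omega> = d} \<noteq> {}"
    unfolding absorption_time_def by (metis Inf_enat_def enat_ord_code(5) infinity_ileE)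
  then have "absorption_time d X \<omega> \<in> enat ` {n. X n \<omega> = d}"
    unfolding absorption_time_def Inf_enat_def by (auto intro: LeastI)
  then show "\<exists>m\<le>n. X m \<omega> = d" using le by auto
next
  assume "\<exists>m\<le>n. X m \<omega> = d"
  then obtain m where "m \<le> n" "X m \<omega> = d" by blast
  then have "absorption_time d X \<omega> \<le> enat m" unfolding absorption_time_def by (intro Inf_lower) auto
  then show "absorption_time d X \<omega> \<le> enat n" using \<open>m \<le> n\<close> by (meson enat_ord_simps(1) order_trans)
qed

lemma absorption_time_eq_iff:
  "absorption_time d X \<omega> = enat n \<longleftrightarrow> X n \<omega> = d \<and> (\<forall>m<n. X m \<omega> \<noteq> d)"
proof
  assume eq: "absorption_time d X \<omega> = enat n"
  have before: "X m \<omega> \<noteq> d" if "m < n" for m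
  proof
    assume "X m \<omega> = d"
    then have "absorption_time d X \<omega> \<le> enat m" unfolding absorption_time_le_iff by blast
    then show False using eq that by simp
  qed
  have "absorption_time d X \<omega> \<le> enat n" using eq by simp
  then obtain m where "m \<le> n" "X m \<omega> = d" unfolding absorption_time_le_iff by blast
  then show "X n \<omega> = d \<and> (\<forall>m<n. X m \<omega> \<noteq> d)" using before by (cases "m = n") auto
next
  assume hit: "X n \<omega> = d \<and> (\<forall>m<n. X m \<omega> \<noteq> d)"
  then have "absorption_time d X \<omega> \<le> enat n" unfolding absorption_time_le_iff by blast
  then obtain k where k: "absorption_time d X \<omega> = enat k" "k \<le> n"
    by (cases "absorption_time d X \<omega>") auto
  then obtain m where "m \<le> k" "X m \<omega> = d" using absorption_time_le_iff[of d X \<omega> k] by auto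
  then show "absorption_time d X \<omega> = enat n" using hit k by (cases "m < n") auto
qed

section \<open>The coupling of a chain with its dual\<close>

text \<open>The Diaconis-Fill coupling: given the move of \<open>X\<close> to \<open>y\<close>, the dual moves from \<open>xs\<close> to \<open>ys\<close>
  with probability proportional to \<open>Ps xs ys * \<Lambda> ys y\<close>; the normalising constant can only vanish
  on pairs that the coupled chain does not visit.\<close>

definition coupling_kernel ::
  "nat \<Rightarrow> (nat \<Rightarrow> nat \<Rightarrow> real) \<Rightarrow> (nat \<Rightarrow> nat \<Rightarrow> real) \<Rightarrow> (nat \<Rightarrow> nat \<Rightarrow> real) \<Rightarrow> nat \<times> nat \<Rightarrow> nat \<times> nat \<Rightarrow> real"
where
  "coupling_kernel d P \<Lambda> Ps = (\<lambda>(xs, x) (ys, y). P x y *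
     (if kernel_mult d Ps \<Lambda> xs y = 0 then Ps xs ys
      else Ps xs ys * \<Lambda> ys y / kernel_mult d Ps \<Lambda> xs y))"

text \<open>The weights multiplying \<open>P x y\<close> sum to 1 over \<open>ys\<close> in both
  branches. Hence \<open>X\<close> moves by \<open>P\<close> whatever the state of the dual, which
  makes it Markov in the joint history.\<close>

lemma coupling_kernel_row:
  assumes "stochastic_on {..d} Ps" "xs \<le> d"
  shows "(\<Sum>ys\<le>d. coupling_kernel d P \<Lambda> Ps (xs, x) (ys, y)) = P x y"
proof (cases "kernel_mult d Ps \<Lambda> xs y = 0")
  case True
  then show ?thesis using assms by (simp add: coupling_kernel_def stochastic_on_def flip: sum_distrib_left)
next
  case False
  then show ?thesis
    by (simp add: coupling_kernel_def kernel_mult_def flip: sum_distrib_left sum_divide_distrib)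
qed

lemma coupling_kernel_stochastic:
  assumes P: "stochastic_on {..d} P" and Ps: "stochastic_on {..d} Ps" and \<Lambda>: "stochastic_on {..d} \<Lambda>"
  shows "stochastic_on ({..d} \<times> {..d}) (coupling_kernel d P \<Lambda> Ps)"
  unfolding stochastic_on_def
proof (intro ballI conjI)
  fix s t assume "s \<in> {..d} \<times> {..d}" "t \<in> {..d} \<times> {..d}"
  then show "0 \<le> coupling_kernel d P \<Lambda> Ps s t"
    using assms by (auto simp: coupling_kernel_def stochastic_on_def kernel_mult_def
        intro!: mult_nonneg_nonneg divide_nonneg_nonneg sum_nonneg)
next
  fix s assume "s \<in> {..d} \<times> {..d}"
  then obtain xs x where s: "s = (xs, x)" "xs \<le> d" "x \<le> d" by auto
  have "(\<Sum>t\<in>{..d} \<times> {..d}. coupling_kernel d P \<Lambda> Ps s t)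
      = (\<Sum>ys\<le>d. \<Sum>y\<le>d. coupling_kernel d P \<Lambda> Ps (xs, x) (ys, y))"
    by (simp add: sum.cartesian_product s)
  also have "\<dots> = (\<Sum>y\<le>d. P x y)"
    by (subst sum.swap) (simp add: coupling_kernel_row[OF Ps s(2)])
  also have "\<dots> = 1" using P s by (simp add: stochastic_on_def)
  finally show "(\<Sum>t\<in>{..d} \<times> {..d}. coupling_kernel d P \<Lambda> Ps s t) = 1" .
qed

text \<open>Averaging \<open>P x y\<close> over row \<open>xs\<close> of the link produces, by the
  intertwining relation, exactly the normalising constant, which cancels. This is the one-step form
  of the invariant that \<open>X\<close> has law \<open>\<Lambda> xs\<close> given the history of
  the dual.\<close>

lemma coupling_kernel_link:
  assumes Ps: "stochastic_on {..d} Ps" and \<Lambda>: "stochastic_on {..d} \<Lambda>"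
    and dual: "\<And>i j. i \<le> d \<Longrightarrow> j \<le> d \<Longrightarrow> kernel_mult d \<Lambda> P i j = kernel_mult d Ps \<Lambda> i j"
    and le: "xs \<le> d" "ys \<le> d" "y \<le> d"
  shows "(\<Sum>x\<le>d. \<Lambda> xs x * coupling_kernel d P \<Lambda> Ps (xs, x) (ys, y)) = Ps xs ys * \<Lambda> ys y"
proof -
  let ?D = "kernel_mult d Ps \<Lambda> xs y"
  let ?w = "if ?D = 0 then Ps xs ys else Ps xs ys * \<Lambda> ys y / ?D"
  have "(\<Sum>x\<le>d. \<Lambda> xs x * coupling_kernel d P \<Lambda> Ps (xs, x) (ys, y)) = (\<Sum>x\<le>d. \<Lambda> xs x * P x y) * ?w"
    unfolding sum_distrib_right by (rule sum.cong) (simp_all add: coupling_kernel_def)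
  also have "(\<Sum>x\<le>d. \<Lambda> xs x * P x y) = ?D" using dual[OF le(1,3)] by (simp add: kernel_mult_def)
  also have "?D * ?w = Ps xs ys * \<Lambda> ys y"
  proof (cases "?D = 0")
    case True
    \<comment> \<open>A vanishing sum of nonnegative terms has only zero terms, so the right-hand
      side vanishes as well and the substitute weights do no harm.\<close>
    have "\<forall>k\<in>{..d}. Ps xs k * \<Lambda> k y = 0"
      using True Ps \<Lambda> le unfolding kernel_mult_def
      by (subst (asm) sum_nonneg_eq_0_iff) (auto simp: stochastic_on_def)
    then show ?thesis using True le by simp
  qed simp
  finally show ?thesis .
qed

section \<open>The coupled pair and its marginal chains\<close>

locale coupled_chains =
  fixes d :: nat and P Ps \<Lambda> :: "nat \<Rightarrow> nat \<Rightarrow> real" and \<pi> :: "nat \<Rightarrow> real"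
    and M :: "'w measure" and Xs X :: "nat \<Rightarrow> 'w \<Rightarrow> nat"
  assumes dual: "strong_stationary_dual d P \<pi> \<Lambda> Ps"
    and chain: "markov_chain M ({..d} \<times> {..d}) (\<lambda>s. of_bool (s = (0, 0)))
      (coupling_kernel d P \<Lambda> Ps) (\<lambda>n \<omega>. (Xs n \<omega>, X n \<omega>))"
begin

abbreviation "Z \<equiv> \<lambda>n \<omega>. (Xs n \<omega>, X n \<omega>)"
abbreviation "joint_filtration \<equiv> natural_filtration M ({..d} \<times> {..d}) Z"
abbreviation "dual_filtration \<equiv> natural_filtration M {..d} Xs"

definition cell :: "nat \<Rightarrow> nat \<Rightarrow> nat \<Rightarrow> 'w set" where
  "cell n xs x = level M Xs n xs \<inter> level M X n x"

lemma cell_eq_level: "cell n xs x = level M Z n (xs, x)"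
  by (auto simp: cell_def)

lemmas dual_facts = dual[unfolded strong_stationary_dual_def ergodic_kernel_def stationary_distribution_def]

lemma kernels: "stochastic_on {..d} P" "stochastic_on {..d} Ps" "stochastic_on {..d} \<Lambda>"
  and intertwine: "i \<le> d \<Longrightarrow> j \<le> d \<Longrightarrow> kernel_mult d \<Lambda> P i j = kernel_mult d Ps \<Lambda> i j"
  and link_0: "j \<le> d \<Longrightarrow> \<Lambda> 0 j = of_bool (j = 0)" and link_d: "j \<le> d \<Longrightarrow> \<Lambda> d j = \<pi> j"
  and link_row: "i \<le> d \<Longrightarrow> (\<Sum>j\<le>d. \<Lambda> i j) = 1"
  and stationary: "j \<le> d \<Longrightarrow> (\<Sum>i\<le>d. \<pi> i * P i j) = \<pi> j"
  using dual_facts by (auto simp: stochastic_on_def)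

lemmas chain_facts = chain[unfolded markov_chain_def markov_wrt_iff[OF finite_cartesian_product[OF finite_atMost finite_atMost]]]

sublocale prob_space M using chain_facts by blast

lemma Z_measurable: "Z n \<in> joint_filtration n \<rightarrow>\<^sub>M count_space ({..d} \<times> {..d})"
  using chain_facts by blast

lemma joint_subalgebra: "subalgebra M (joint_filtration n)"
  using chain_facts by blast

lemma space_joint: "space (joint_filtration n) = space M"
  by (rule natural_filtration_space)

lemma sets_joint: "A \<in> sets (joint_filtration n) \<Longrightarrow> A \<in> sets M"
  using joint_subalgebra by (auto simp: subalgebra_def)

lemma marginals_joint:
  assumes "i \<le> n"
  shows "Xs i \<in> joint_filtration n \<rightarrow>\<^sub>M count_space {..d}"
    and "X i \<in> joint_filtration n \<rightarrow>\<^sub>M count_space {..d}"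
proof -
  have in_S: "Z i \<omega> \<in> {..d} \<times> {..d}" if "\<omega> \<in> space M" for \<omega>
    using measurable_space[OF Z_measurable, of \<omega> i] that by (simp add: space_joint)
  have Z: "Z i \<in> joint_filtration n \<rightarrow>\<^sub>M count_space ({..d} \<times> {..d})"
    using in_S assms by (rule natural_filtration_adapted)
  show "Xs i \<in> joint_filtration n \<rightarrow>\<^sub>M count_space {..d}"
  proof -
    have "(\<lambda>\<omega>. fst (Z i \<omega>)) \<in> joint_filtration n \<rightarrow>\<^sub>M count_space {..d}"
      by (rule measurable_compose[OF Z]) auto
    then show ?thesis by simp
  qed
  show "X i \<in> joint_filtration n \<rightarrow>\<^sub>M count_space {..d}"
  proof -
    have "(\<lambda>\<omega>. snd (Z i \<omega>)) \<in> joint_filtration n \<rightarrow>\<^sub>M count_space {..d}"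
      by (rule measurable_compose[OF Z]) auto
    then show ?thesis by simp
  qed
qed

lemma marginals_measurable: "Xs n \<in> M \<rightarrow>\<^sub>M count_space {..d}" "X n \<in> M \<rightarrow>\<^sub>M count_space {..d}"
  using measurable_from_subalg[OF joint_subalgebra marginals_joint(1)[OF order_refl]]
    measurable_from_subalg[OF joint_subalgebra marginals_joint(2)[OF order_refl]] .

lemma levels: "s \<le> d \<Longrightarrow> level M Xs n s \<in> sets M" "s \<le> d \<Longrightarrow> level M X n s \<in> sets M"
  using level_in_sets[OF marginals_measurable(1)] level_in_sets[OF marginals_measurable(2)] by simp_all

lemma dual_sub_joint: "A \<in> sets (dual_filtration n) \<Longrightarrow> A \<in> sets (joint_filtration n)"
proof -
  have "sets (dual_filtration n) \<subseteq> sets (joint_filtration n)"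
    by (rule natural_filtration_least) (simp_all add: marginals_joint space_joint)
  then show "A \<in> sets (dual_filtration n) \<Longrightarrow> A \<in> sets (joint_filtration n)" by blast
qed

lemma sum_levels:
  assumes A: "A \<in> sets M"
  shows "x \<le> d \<Longrightarrow> measure M (A \<inter> level M X n x) = (\<Sum>xs\<le>d. measure M (A \<inter> cell n xs x))"
    and "xs \<le> d \<Longrightarrow> measure M (A \<inter> level M Xs n xs) = (\<Sum>x\<le>d. measure M (A \<inter> cell n xs x))"
proof -
  have 1: "A \<inter> level M X n x \<inter> level M Xs n xs = A \<inter> cell n xs x"
    and 2: "A \<inter> level M Xs n xs \<inter> level M X n x = A \<inter> cell n xs x" for xs x by (auto simp: cell_def)
  show "measure M (A \<inter> level M X n x) = (\<Sum>xs\<le>d. measure M (A \<inter> cell n xs x))" if "x \<le> d"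
    using measure_partition[OF marginals_measurable(1)[of n] finite_atMost sets.Int[OF A levels(2)[OF that]]]
    by (simp only: 1)
  show "measure M (A \<inter> level M Xs n xs) = (\<Sum>x\<le>d. measure M (A \<inter> cell n xs x))" if "xs \<le> d"
    using measure_partition[OF marginals_measurable(2)[of n] finite_atMost sets.Int[OF A levels(1)[OF that]]]
    by (simp only: 2)
qed

lemma step_joint:
  assumes "A \<in> sets (joint_filtration n)" "ys \<le> d" "y \<le> d"
  shows "measure M (A \<inter> cell (Suc n) ys y)
    = (\<Sum>xs\<le>d. \<Sum>x\<le>d. measure M (A \<inter> cell n xs x) * coupling_kernel d P \<Lambda> Ps (xs, x) (ys, y))"
proof -
  have "(ys, y) \<in> {..d} \<times> {..d}" using assms by simp
  then have "measure M (A \<inter> cell (Suc n) ys y) = (\<Sum>s\<in>{..d} \<times> {..d}.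
      measure M (A \<inter> level M Z n s) * coupling_kernel d P \<Lambda> Ps s (ys, y))"
    unfolding cell_eq_level using chain_facts assms(1) by blast
  also have "\<dots> = (\<Sum>s\<in>{..d} \<times> {..d}. case s of (xs, x) \<Rightarrow>
      measure M (A \<inter> cell n xs x) * coupling_kernel d P \<Lambda> Ps (xs, x) (ys, y))"
    by (rule sum.cong[OF refl]) (auto simp: cell_def intro!: arg_cong[of _ _ "measure M"])
  finally show ?thesis by (simp only: sum.cartesian_product)
qed

lemma init_joint:
  assumes "xs \<le> d" "x \<le> d"
  shows "measure M (cell 0 xs x) = of_bool (xs = 0 \<and> x = 0)"
proof -
  have "(xs, x) \<in> {..d} \<times> {..d}" using assms by simp
  then have "measure M (cell 0 xs x) = of_bool ((xs, x) = (0, 0))"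
    unfolding cell_eq_level using chain_facts by blast
  then show ?thesis by simp
qed

lemma init_marginals:
  assumes "s \<le> d"
  shows "measure M (level M X 0 s) = of_bool (s = 0)" "measure M (level M Xs 0 s) = of_bool (s = 0)"
proof -
  have *: "space M \<inter> level M Y n s = level M Y n s" "space M \<inter> cell n xs x = cell n xs x"
    for Y :: "nat \<Rightarrow> 'w \<Rightarrow> nat" and n s xs x by (auto simp: cell_def)
  show "measure M (level M X 0 s) = of_bool (s = 0)"
    using sum_levels(1)[OF sets.top assms, of 0] assms
    unfolding * by (simp add: init_joint of_bool_conj)
  show "measure M (level M Xs 0 s) = of_bool (s = 0)"
    using sum_levels(2)[OF sets.top assms, of 0] assms
    unfolding * by (simp add: init_joint of_bool_conj)
qed

text \<open>Revealing the history of the dual does not disturb the Markov property of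
  \<open>X\<close>. The joint filtration is therefore the one that exhibits the absorption time of
  the dual as a randomized stopping time for \<open>X\<close>.\<close>

lemma X_markov_joint: "markov_wrt M joint_filtration {..d} (\<lambda>s. of_bool (s = 0)) P X"
  unfolding markov_wrt_iff[OF finite_atMost]
proof (intro conjI allI ballI)
  fix n y A assume "y \<in> {..d}" and A: "A \<in> sets (joint_filtration n)"
  then have y: "y \<le> d" by simp
  let ?m = "\<lambda>xs x. measure M (A \<inter> cell n xs x)"
  have "measure M (A \<inter> level M X (Suc n) y)
      = (\<Sum>ys\<le>d. \<Sum>xs\<le>d. \<Sum>x\<le>d. ?m xs x * coupling_kernel d P \<Lambda> Ps (xs, x) (ys, y))"
    using sum_levels(1)[OF sets_joint[OF A] y] step_joint[OF A _ y] by simp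
  also have "\<dots> = (\<Sum>xs\<le>d. \<Sum>x\<le>d. \<Sum>ys\<le>d. ?m xs x * coupling_kernel d P \<Lambda> Ps (xs, x) (ys, y))"
    by (subst sum.swap) (rule sum.cong[OF refl], rule sum.swap)
  also have "\<dots> = (\<Sum>xs\<le>d. \<Sum>x\<le>d. ?m xs x * P x y)"
    by (simp add: coupling_kernel_row[OF kernels(2)] flip: sum_distrib_left)
  also have "\<dots> = (\<Sum>x\<le>d. (\<Sum>xs\<le>d. ?m xs x) * P x y)"
    by (subst sum.swap) (simp add: sum_distrib_right)
  also have "\<dots> = (\<Sum>x\<le>d. measure M (A \<inter> level M X n x) * P x y)"
    by (rule sum.cong) (simp_all add: sum_levels(1)[OF sets_joint[OF A]])
  finally show "measure M (A \<inter> level M X (Suc n) y) = (\<Sum>x\<in>{..d}. measure M (A \<inter> level M X n x) * P x y)" .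
qed (use natural_filtration_filtration joint_subalgebra marginals_joint init_marginals
    prob_space_axioms in simp_all)

text \<open>The conditional law at time \<open>n\<close> is an assumption here so that the same
  computation serves twice: with the induction hypothesis in \<open>conditional_law\<close>, and
  with the finished statement in \<open>Xs_markov\<close>. The second conclusion is the first summed
  over \<open>y\<close>, since the rows of the link sum to 1.\<close>

lemma link_step:
  assumes link: "\<And>A xs x. A \<in> sets (dual_filtration n) \<Longrightarrow> xs \<le> d \<Longrightarrow> x \<le> d \<Longrightarrow>
      measure M (A \<inter> cell n xs x) = measure M (A \<inter> level M Xs n xs) * \<Lambda> xs x"
    and A: "A \<in> sets (dual_filtration n)" and ys: "ys \<le> d"
  shows "y \<le> d \<Longrightarrow> measure M (A \<inter> cell (Suc n) ys y)
      = (\<Sum>xs\<le>d. measure M (A \<inter> level M Xs n xs) * Ps xs ys) * \<Lambda> ys y"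
    and "measure M (A \<inter> level M Xs (Suc n) ys) = (\<Sum>xs\<le>d. measure M (A \<inter> level M Xs n xs) * Ps xs ys)"
proof -
  show eq: "measure M (A \<inter> cell (Suc n) ys y)
      = (\<Sum>xs\<le>d. measure M (A \<inter> level M Xs n xs) * Ps xs ys) * \<Lambda> ys y" if y: "y \<le> d" for y
  proof -
    have "measure M (A \<inter> cell (Suc n) ys y) = (\<Sum>xs\<le>d. measure M (A \<inter> level M Xs n xs) *
        (\<Sum>x\<le>d. \<Lambda> xs x * coupling_kernel d P \<Lambda> Ps (xs, x) (ys, y)))"
      unfolding step_joint[OF dual_sub_joint[OF A] ys y] sum_distrib_left
      by (intro sum.cong refl) (simp add: link[OF A])
    also have "\<dots> = (\<Sum>xs\<le>d. measure M (A \<inter> level M Xs n xs) * (Ps xs ys * \<Lambda> ys y))"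
      using ys y by (intro sum.cong refl) (simp add: coupling_kernel_link[OF kernels(2,3) intertwine])
    finally show ?thesis by (simp add: sum_distrib_right mult.assoc)
  qed
  show "measure M (A \<inter> level M Xs (Suc n) ys) = (\<Sum>xs\<le>d. measure M (A \<inter> level M Xs n xs) * Ps xs ys)"
    using sum_levels(2)[OF sets_joint[OF dual_sub_joint[OF A]] ys] eq
    by (simp add: link_row[OF ys] flip: sum_distrib_left)
qed

text \<open>The central invariant of the coupling. It starts because both chains sit at 0, where the
  row of the link is a point mass.\<close>

lemma conditional_law:
  assumes "A \<in> sets (dual_filtration n)" "xs \<le> d" "x \<le> d"
  shows "measure M (A \<inter> cell n xs x) = measure M (A \<inter> level M Xs n xs) * \<Lambda> xs x"
  using assms
proof (induction n arbitrary: A xs x)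
  case 0
  have A: "A \<in> sets M" using 0(1) dual_sub_joint sets_joint by blast
  have null: "measure M (A \<inter> cell 0 xs x) = 0" if "xs \<le> d" "x \<le> d" "xs \<noteq> 0 \<or> x \<noteq> 0" for xs x
  proof -
    have "cell 0 xs x \<in> sets M"
      unfolding cell_def using levels that by blast
    then have "measure M (A \<inter> cell 0 xs x) \<le> measure M (cell 0 xs x)"
      by (intro finite_measure_mono) auto
    also have "\<dots> = 0" using init_joint[OF that(1,2)] that(3) by auto
    finally show ?thesis by (simp add: measure_le_0_iff)
  qed
  have Xs: "measure M (A \<inter> level M Xs 0 xs) = measure M (A \<inter> cell 0 xs 0)"
  proof -
    have "measure M (A \<inter> level M Xs 0 xs) = (\<Sum>x\<le>d. measure M (A \<inter> cell 0 xs x))"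
      by (rule sum_levels(2)[OF A 0(2)])
    also have "\<dots> = (\<Sum>x\<in>{0}. measure M (A \<inter> cell 0 xs x))"
      using null 0(2) by (intro sum.mono_neutral_right) auto
    finally show ?thesis by simp
  qed
  show ?case
  proof (cases "xs = 0")
    case True
    then show ?thesis using Xs null[of 0 x] link_0[OF 0(3)] 0(3) by simp
  next
    case False
    then show ?thesis unfolding Xs using null[OF 0(2)] 0(3) by simp
  qed
next
  case (Suc n)
  \<comment> \<open>\<open>A\<close> may involve \<open>Xs (Suc n)\<close>, but both sides only see
    \<open>A\<close> on a level set of that variable, where it agrees with an event of the earlier
    history.\<close>
  obtain A' where A': "A' \<in> sets (dual_filtration n)"
    and AA': "A \<inter> level M Xs (Suc n) xs = A' \<inter> level M Xs (Suc n) xs"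
    using natural_filtration_Suc_decompose[OF Suc.prems(1)] by blast
  have "A \<inter> cell (Suc n) xs x = A' \<inter> cell (Suc n) xs x"
    using AA' unfolding cell_def by blast
  then show ?case
    unfolding AA' using link_step[OF Suc.IH A' Suc.prems(2)] Suc.prems(3) by simp
qed

lemma Xs_markov: "markov_chain M {..d} (\<lambda>s. of_bool (s = 0)) Ps Xs"
proof (rule markov_chainI[OF finite_atMost prob_space_axioms marginals_measurable(1)])
  show "measure M (level M Xs 0 s) = of_bool (s = 0)" if "s \<in> {..d}" for s
    using init_marginals(2)[of s] that by simp
  fix n t A assume "t \<in> {..d}" "A \<in> sets (dual_filtration n)"
  then show "measure M (A \<inter> level M Xs (Suc n) t) = (\<Sum>s\<in>{..d}. measure M (A \<inter> level M Xs n s) * Ps s t)"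
    using link_step(2)[OF conditional_law] by simp
qed

lemma law_relation:
  assumes "x \<le> d"
  shows "measure M (level M X n x) = (\<Sum>xs\<le>d. measure M (level M Xs n xs) * \<Lambda> xs x)"
proof -
  have top: "space M \<in> sets (dual_filtration n)"
    using sets.top[of "dual_filtration n"] by (simp add: natural_filtration_space)
  have *: "space M \<inter> level M Y n s = level M Y n s" "space M \<inter> cell n xs x = cell n xs x"
    for Y :: "nat \<Rightarrow> 'w \<Rightarrow> nat" and n s xs x by (auto simp: cell_def)
  show ?thesis
    using sum_levels(1)[OF sets.top assms, of n] conditional_law[OF top _ assms] unfolding * by simp
qed

section \<open>The absorption time as a fastest strong stationary time\<close>

abbreviation "T \<equiv> absorption_time d Xs"

definition hit :: "nat \<Rightarrow> 'w set" where
  "hit n = {\<omega> \<in> space M. T \<omega> = enat n}"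

lemma hit_dual: "hit n \<in> sets (dual_filtration n)"
proof -
  have Xs: "Xs i \<in> dual_filtration n \<rightarrow>\<^sub>M count_space {..d}" if "i \<le> n" for i
    using measurable_space[OF marginals_measurable(1)] that by (intro natural_filtration_adapted) auto
  have lev: "level M Xs i d \<in> sets (dual_filtration n)" if "i \<le> n" for i
    by (rule level_in_sets[where X = Xs and n = i, OF Xs[OF that]]) (simp_all add: natural_filtration_space)
  have "hit n = level M Xs n d - (\<Union>i<n. level M Xs i d)"
    by (auto simp: hit_def absorption_time_eq_iff)
  then show ?thesis using lev by (auto intro!: sets.Diff sets.finite_UN)
qed

lemma hit_sets: "hit n \<in> sets M"
  using hit_dual dual_sub_joint sets_joint by blast

lemma T_stopping_time: "{\<omega> \<in> space M. T \<omega> \<le> enat n} \<in> sets (joint_filtration n)"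
proof -
  have "level M Xs i d \<in> sets (joint_filtration n)" if "i \<le> n" for i
    by (rule level_in_sets[where X = Xs and n = i, OF marginals_joint(1)[OF that]]) (simp_all add: space_joint)
  moreover have "{\<omega> \<in> space M. T \<omega> \<le> enat n} = (\<Union>i\<le>n. level M Xs i d)"
    by (auto simp: absorption_time_le_iff)
  ultimately show ?thesis by (auto intro!: sets.finite_UN)
qed

lemma T_measurable: "T \<in> M \<rightarrow>\<^sub>M count_space UNIV"
proof (rule measurable_count_space_eq2_countable[THEN iffD2], intro conjI ballI)
  fix t :: enat
  have hit: "T -` {enat n} \<inter> space M = hit n" for n by (auto simp: hit_def)
  show "T -` {t} \<inter> space M \<in> sets M"
  proof (cases t)
    case (enat n)
    then show ?thesis using hit hit_sets by simp
  next
    case infinity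
    have "T -` {t} \<inter> space M = space M - (\<Union>n. hit n)"
      using infinity by (auto simp: hit_def not_infinity_eq)
    then show ?thesis using hit_sets by auto
  qed
qed auto

lemma X_T_measurable: "(\<lambda>\<omega>. X (the_enat (T \<omega>)) \<omega>) \<in> M \<rightarrow>\<^sub>M count_space {..d}"
  by (rule measurable_compose_countable[where g = "\<lambda>\<omega>. the_enat (T \<omega>)", OF marginals_measurable(2)])
    (rule measurable_compose[OF T_measurable], simp)

text \<open>\<open>hit n\<close> belongs to the history of the dual and forces the dual to be at
  \<open>d\<close>, where the row of the link is \<pi>.\<close>

lemma hit_X_law: "x \<le> d \<Longrightarrow> measure M (hit n \<inter> level M X n x) = measure M (hit n) * \<pi> x"
proof -
  assume x: "x \<le> d"
  have "hit n \<inter> level M X n x = hit n \<inter> cell n d x" "hit n = hit n \<inter> level M Xs n d"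
    by (auto simp: hit_def absorption_time_eq_iff cell_def)
  then show ?thesis using conditional_law[OF hit_dual order_refl x] link_d[OF x] by simp
qed

text \<open>Being at \<open>d\<close> at time \<open>n\<close> implies absorption by time
  \<open>n\<close>. This one-sided bound serves both the finiteness of \<open>T\<close> and its
  minimality.\<close>

lemma not_absorbed_le: "measure M {\<omega> \<in> space M. enat n < T \<omega>} \<le> 1 - measure M (level M Xs n d)"
proof -
  have "{\<omega> \<in> space M. enat n < T \<omega>} \<subseteq> space M - level M Xs n d"
    using absorption_time_le_iff[of d Xs _ n] by (auto simp: not_le[symmetric])
  then have "measure M {\<omega> \<in> space M. enat n < T \<omega>} \<le> measure M (space M - level M Xs n d)"
    using levels(1)[OF order_refl] by (intro finite_measure_mono) auto
  then show ?thesis using prob_compl[OF levels(1)[OF order_refl]] by simp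
qed

lemma Xs_law: "j \<le> d \<Longrightarrow> measure M (level M Xs n j) = kernel_power d Ps n 0 j"
  using markov_wrt_law_power Xs_markov unfolding markov_chain_def by blast

lemma T_finite:
  assumes absorb: "(\<lambda>n. kernel_power d Ps n 0 d) \<longlonglongrightarrow> 1"
  shows "AE \<omega> in M. T \<omega> < \<infinity>"
proof -
  let ?N = "T -` {\<infinity>} \<inter> space M"
  have N: "?N \<in> sets M" using measurable_sets[OF T_measurable, of "{\<infinity>}"] by simp
  have le: "measure M ?N \<le> 1 - kernel_power d Ps n 0 d" for n
  proof -
    have "{\<omega> \<in> space M. enat n < T \<omega>} = T -` {enat n<..} \<inter> space M" by auto
    then have "{\<omega> \<in> space M. enat n < T \<omega>} \<in> sets M" using measurable_sets[OF T_measurable] by simp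
    then have "measure M ?N \<le> measure M {\<omega> \<in> space M. enat n < T \<omega>}"
      by (intro finite_measure_mono) auto
    then show ?thesis using not_absorbed_le[of n] Xs_law[OF order_refl, of n] by simp
  qed
  have "(\<lambda>n. 1 - kernel_power d Ps n 0 d) \<longlonglongrightarrow> 1 - 1" by (intro tendsto_diff tendsto_const absorb)
  then have "measure M ?N \<le> 0" using le by (intro LIMSEQ_le_const[of _ 0]) auto
  then have "?N \<in> null_sets M"
    using N by (simp add: null_sets_def emeasure_eq_measure measure_le_0_iff)
  then show ?thesis by (rule AE_I') auto
qed

text \<open>As \<open>T\<close> is almost surely finite, the events \<open>hit n\<close> partition
  the space up to a null set. On each of them \<open>T\<close> is constant and the state has law
  \<pi> by \<open>hit_X_law\<close>; summing over \<open>n\<close> gives the product form.\<close>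

lemma X_T_law:
  assumes absorb: "(\<lambda>n. kernel_power d Ps n 0 d) \<longlonglongrightarrow> 1" and x: "x \<le> d"
  shows "measure M ({\<omega> \<in> space M. X (the_enat (T \<omega>)) \<omega> = x} \<inter> (T -` B \<inter> space M))
    = \<pi> x * measure M (T -` B \<inter> space M)"
proof -
  let ?a = "{\<omega> \<in> space M. X (the_enat (T \<omega>)) \<omega> = x}" and ?b = "T -` B \<inter> space M"
  have a: "?a \<in> sets M"
    by (rule level_in_sets[where X = "\<lambda>_ \<omega>. X (the_enat (T \<omega>)) \<omega>" and n = 0, OF X_T_measurable])
      (use x in auto)
  have b: "?b \<in> sets M" using measurable_sets[OF T_measurable, of B] by simp
  have sums: "(\<lambda>n. measure M (c \<inter> hit n)) sums measure M c" if c: "c \<in> sets M" for c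
  proof -
    have "(\<lambda>n. measure M (c \<inter> hit n)) sums measure M (\<Union>n. c \<inter> hit n)"
      using c hit_sets by (intro finite_measure_UNION) (auto simp: disjoint_family_on_def hit_def)
    also have "measure M (\<Union>n. c \<inter> hit n) = measure M c"
    proof (rule finite_measure_eq_AE)
      show "AE \<omega> in M. \<omega> \<in> (\<Union>n. c \<inter> hit n) \<longleftrightarrow> \<omega> \<in> c"
        using T_finite[OF absorb] AE_space by eventually_elim (auto simp: hit_def)
    qed (use c hit_sets in auto)
    finally show ?thesis .
  qed
  have "measure M (?a \<inter> ?b \<inter> hit n) = \<pi> x * measure M (?b \<inter> hit n)" for n
  proof (cases "enat n \<in> B")
    case True
    then have "?a \<inter> ?b \<inter> hit n = hit n \<inter> level M X n x" "?b \<inter> hit n = hit n"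
      by (auto simp: hit_def)
    then show ?thesis using hit_X_law[OF x] by simp
  next
    case False
    then have "?a \<inter> ?b \<inter> hit n = {}" "?b \<inter> hit n = {}" by (auto simp: hit_def)
    then show ?thesis by (simp only: measure_empty mult_zero_right)
  qed
  then have "(\<lambda>n. \<pi> x * measure M (?b \<inter> hit n)) sums measure M (?a \<inter> ?b)"
    using sums[OF sets.Int[OF a b]] by simp
  moreover have "(\<lambda>n. \<pi> x * measure M (?b \<inter> hit n)) sums (\<pi> x * measure M ?b)"
    by (rule sums_mult[OF sums[OF b]])
  ultimately show ?thesis by (rule sums_unique2)
qed

lemma T_strong_stationary:
  assumes absorb: "(\<lambda>n. kernel_power d Ps n 0 d) \<longlonglongrightarrow> 1"
  shows "strong_stationary_time M {..d} (\<lambda>s. of_bool (s = 0)) P \<pi> X T"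
proof -
  let ?Y = "\<lambda>\<omega>. X (the_enat (T \<omega>)) \<omega>"
  have law: "measure M {\<omega> \<in> space M. ?Y \<omega> = x} = \<pi> x" if "x \<le> d" for x
  proof -
    have "{\<omega> \<in> space M. ?Y \<omega> = x} \<inter> (T -` UNIV \<inter> space M) = {\<omega> \<in> space M. ?Y \<omega> = x}"
      "T -` UNIV \<inter> space M = space M" by auto
    then show ?thesis using X_T_law[OF absorb that, of UNIV] by (simp add: prob_space)
  qed
  \<comment> \<open>\<open>X_T_law\<close> treats single states; finite additivity reduces a set of
    states to them.\<close>
  have joint: "measure M (?Y -` A \<inter> space M \<inter> c)
      = (\<Sum>x\<in>A. measure M ({\<omega> \<in> space M. ?Y \<omega> = x} \<inter> c))" if A: "A \<subseteq> {..d}" and c: "c \<in> sets M" for A c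
  proof -
    let ?a = "?Y -` A \<inter> space M"
    have a: "?a \<in> sets M" using measurable_sets[OF X_T_measurable, of A] A by simp
    have "measure M (?a \<inter> c) = (\<Sum>x\<le>d. measure M (?a \<inter> c \<inter> {\<omega> \<in> space M. ?Y \<omega> = x}))"
      by (rule measure_partition[OF X_T_measurable finite_atMost sets.Int[OF a c]])
    also have "\<dots> = (\<Sum>x\<in>A. measure M ({\<omega> \<in> space M. ?Y \<omega> = x} \<inter> c))"
    proof (rule sum.mono_neutral_cong_right)
      show "\<forall>x\<in>{..d} - A. measure M (?a \<inter> c \<inter> {\<omega> \<in> space M. ?Y \<omega> = x}) = 0"
      proof
        fix x assume "x \<in> {..d} - A"
        then have "?a \<inter> c \<inter> {\<omega> \<in> space M. ?Y \<omega> = x} = {}" by auto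
        then show "measure M (?a \<inter> c \<inter> {\<omega> \<in> space M. ?Y \<omega> = x}) = 0" by (simp only: measure_empty)
      qed
      fix x assume "x \<in> A"
      then have "?a \<inter> c \<inter> {\<omega> \<in> space M. ?Y \<omega> = x} = {\<omega> \<in> space M. ?Y \<omega> = x} \<inter> c" by auto
      then show "measure M (?a \<inter> c \<inter> {\<omega> \<in> space M. ?Y \<omega> = x}) = measure M ({\<omega> \<in> space M. ?Y \<omega> = x} \<inter> c)"
        by (simp only:)
    qed (use A in auto)
    finally show ?thesis .
  qed
  have "indep_set {?Y -` A \<inter> space M | A. A \<subseteq> {..d}} {T -` B \<inter> space M | B. B \<subseteq> UNIV}"
    unfolding indep_sets2_eq
  proof (intro conjI ballI)
    show "{?Y -` A \<inter> space M | A. A \<subseteq> {..d}} \<subseteq> sets M"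
      using measurable_sets[OF X_T_measurable] by auto
    show "{T -` B \<inter> space M | B. B \<subseteq> UNIV} \<subseteq> sets M"
      using measurable_sets[OF T_measurable] by auto
    fix a b assume "a \<in> {?Y -` A \<inter> space M | A. A \<subseteq> {..d}}" "b \<in> {T -` B \<inter> space M | B. B \<subseteq> UNIV}"
    then obtain A B where A: "A \<subseteq> {..d}" and a: "a = ?Y -` A \<inter> space M" and b: "b = T -` B \<inter> space M"
      by blast
    have bM: "b \<in> sets M" using measurable_sets[OF T_measurable, of B] by (simp add: b)
    have "measure M a = measure M (?Y -` A \<inter> space M \<inter> space M)" by (simp add: a Int_assoc)
    also have "\<dots> = (\<Sum>x\<in>A. measure M ({\<omega> \<in> space M. ?Y \<omega> = x} \<inter> space M))"
      by (rule joint[OF A sets.top])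
    also have "\<dots> = (\<Sum>x\<in>A. \<pi> x)"
    proof (rule sum.cong[OF refl])
      fix x assume "x \<in> A"
      then have "x \<le> d" using A by auto
      moreover have "{\<omega> \<in> space M. ?Y \<omega> = x} \<inter> space M = {\<omega> \<in> space M. ?Y \<omega> = x}" by auto
      ultimately show "measure M ({\<omega> \<in> space M. ?Y \<omega> = x} \<inter> space M) = \<pi> x" using law by simp
    qed
    finally have ma: "measure M a = (\<Sum>x\<in>A. \<pi> x)" .
    have "measure M (a \<inter> b) = (\<Sum>x\<in>A. \<pi> x * measure M b)"
      unfolding a joint[OF A bM] using A X_T_law[OF absorb] by (intro sum.cong) (auto simp: b)
    then show "measure M (a \<inter> b) = measure M a * measure M b"
      by (simp add: ma sum_distrib_right)
  qed
  then show ?thesis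
    unfolding strong_stationary_time_def
    using X_markov_joint T_stopping_time T_finite[OF absorb] law by auto
qed

lemma T_fastest:
  assumes absorb: "(\<lambda>n. kernel_power d Ps n 0 d) \<longlonglongrightarrow> 1"
    and corner: "\<And>i. i < d \<Longrightarrow> \<Lambda> i d = 0" and \<pi>d: "0 < \<pi> d"
  shows "fastest_sst M {..d} (\<lambda>s. of_bool (s = 0)) P \<pi> X T"
  unfolding fastest_sst_def
proof (intro conjI allI impI)
  show "strong_stationary_time M {..d} (\<lambda>s. of_bool (s = 0)) P \<pi> X T"
    using T_strong_stationary[OF absorb] .
  fix N :: "((nat \<Rightarrow> nat) \<times> enat) measure" and Y U n
  assume sst: "strong_stationary_time N {..d} (\<lambda>s. of_bool (s = 0)) P \<pi> Y U"
  then obtain F where mk: "markov_wrt N F {..d} (\<lambda>s. of_bool (s = 0)) P Y"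
    and stop: "{\<omega> \<in> space N. U \<omega> \<le> enat n} \<in> sets (F n)"
    unfolding strong_stationary_time_def by blast
  interpret N: prob_space N using mk by (simp add: markov_wrt_def)
  have sub: "subalgebra N (F n)" and Y: "Y n \<in> F n \<rightarrow>\<^sub>M count_space {..d}"
    using mk by (simp_all add: markov_wrt_def)
  let ?le = "{\<omega> \<in> space N. U \<omega> \<le> enat n}"
  have le: "?le \<in> sets N" using stop sub by (auto simp: subalgebra_def)
  have Yd: "level N Y n d \<in> sets N"
    using level_in_sets[where X = Y and n = n, OF measurable_from_subalg[OF sub Y], of d] by simp
  have "measure N ?le * \<pi> d = measure N (?le \<inter> level N Y n d)"
    using strong_stationary_time_stopped_law[OF finite_atMost sst stationary] by simp
  also have "\<dots> \<le> measure N (level N Y n d)" using Yd by (intro N.finite_measure_mono) auto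
  also have "\<dots> = measure M (level M X n d)"
    using markov_wrt_law_unique[OF finite_atMost mk X_markov_joint] by simp
  also have "\<dots> = (\<Sum>xs\<in>{d}. measure M (level M Xs n xs) * \<Lambda> xs d)"
    unfolding law_relation[OF order_refl] using corner by (intro sum.mono_neutral_right) auto
  also have "\<dots> = measure M (level M Xs n d) * \<pi> d" by (simp add: link_d)
  finally have "measure N ?le \<le> measure M (level M Xs n d)" using \<pi>d by simp
  moreover have "measure N {\<omega> \<in> space N. enat n < U \<omega>} = 1 - measure N ?le"
  proof -
    have "{\<omega> \<in> space N. enat n < U \<omega>} = space N - ?le" by auto
    then show ?thesis using N.prob_compl[OF le] by (simp only:)
  qed
  ultimately show "measure M {\<omega> \<in> space M. enat n < T \<omega>} \<le> measure N {\<omega> \<in> space N. enat n < U \<omega>}"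
    using not_absorbed_le[of n] by linarith
qed

end

text \<open>The assumption \<open>corner\<close> makes \<open>d\<close> a halting state: almost
  surely \<open>X\<close> cannot be there before the dual is absorbed. So
  \<open>prob (X n = d)\<close> measures absorption exactly, up to the positive factor
  \<open>\<pi> d\<close> that is cancelled at the end.\<close>

theorem strong_stationary_dual_sharp:
  assumes dual: "strong_stationary_dual d P \<pi> \<Lambda> Ps"
    and absorb: "(\<lambda>n. kernel_power d Ps n 0 d) \<longlonglongrightarrow> 1"
    and corner: "\<And>i. i < d \<Longrightarrow> \<Lambda> i d = 0" and \<pi>d: "0 < \<pi> d"
  shows "sharp_dual d P \<pi> Ps"
proof -
  let ?S = "{..d} \<times> {..d}" and ?Q = "coupling_kernel d P \<Lambda> Ps"
  have Q: "stochastic_on ?S ?Q"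
    using dual by (intro coupling_kernel_stochastic)
      (simp_all add: strong_stationary_dual_def ergodic_kernel_def)
  have "\<exists>M :: (nat \<Rightarrow> nat \<times> nat) measure. markov_chain M ?S (\<lambda>s. of_bool (s = (0, 0))) ?Q (\<lambda>n \<omega>. \<omega> n)"
    by (rule markov_chain_exists[OF _ Q]) (auto simp: sum.delta)
  then obtain M :: "(nat \<Rightarrow> nat \<times> nat) measure" where
    "markov_chain M ?S (\<lambda>s. of_bool (s = (0, 0))) ?Q (\<lambda>n \<omega>. \<omega> n)" by blast
  then interpret coupled_chains d P Ps \<Lambda> \<pi> M "\<lambda>n \<omega>. fst (\<omega> n)" "\<lambda>n \<omega>. snd (\<omega> n)"
    using dual by unfold_locales simp_all
  show ?thesis
    unfolding sharp_dual_def
    using Q chain Xs_markov T_fastest[OF absorb corner \<pi>d]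
      markov_wrt_imp_markov_chain[OF finite_atMost X_markov_joint]
    by (intro exI conjI)
qed

section \<open>Birth-and-death kernels\<close>

lemma birth_death_row_sum:
  assumes bd: "birth_death_kernel d q r p P" and i: "i \<le> d"
  shows "(\<Sum>j\<le>d. P i j * f j) = q i * f (i - 1) + r i * f i + p i * f (Suc i)"
proof -
  \<comment> \<open>At \<open>i = 0\<close> truncated subtraction makes \<open>i - 1\<close> collide
    with \<open>i\<close>, and at \<open>i = d\<close> the index \<open>Suc i\<close> leaves the
    range; both terms vanish by \<open>q 0 = 0\<close> and \<open>p d = 0\<close>.\<close>
  have "(\<Sum>j\<le>d. P i j * f j) = (\<Sum>j\<le>d. (if j = i - 1 then q i * f j else 0)
      + (if j = i then r i * f j else 0) + (if j = Suc i then p i * f j else 0))"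
    using bd i by (intro sum.cong) (auto simp: birth_death_kernel_def)
  also have "\<dots> = q i * f (i - 1) + r i * f i + p i * f (Suc i)"
    using bd i by (cases "i = d") (auto simp: sum.distrib birth_death_kernel_def)
  finally show ?thesis .
qed

lemma birth_death_rates:
  assumes bd: "birth_death_kernel d q r p P" and i: "i \<le> d"
  shows "q i + r i + p i = 1" "0 \<le> q i" "0 \<le> r i" "0 \<le> p i"
proof -
  show "q i + r i + p i = 1"
  proof -
    have "(\<Sum>j\<le>d. P i j) = 1" using bd i by (auto simp: birth_death_kernel_def stochastic_on_def)
    then show ?thesis using birth_death_row_sum[OF bd i, of "\<lambda>_. 1"] by simp
  qed
  have nn: "0 \<le> P i j" if "j \<le> d" for j
  proof -
    have "stochastic_on {..d} P" using bd by (simp add: birth_death_kernel_def)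
    then show ?thesis using i that by (simp add: stochastic_on_def)
  qed
  have P: "P i j = (if i = Suc j then q i else if i = j then r i else if j = Suc i then p i else 0)"
    if "j \<le> d" for j using bd i that by (simp add: birth_death_kernel_def)
  show "0 \<le> r i" using nn[OF i] P[OF i] by simp
  show "0 \<le> q i"
  proof (cases i)
    case 0 then show ?thesis using bd by (simp add: birth_death_kernel_def)
  next
    case (Suc m) then show ?thesis using nn[of m] P[of m] i by simp
  qed
  show "0 \<le> p i"
  proof (cases "i = d")
    case True then show ?thesis using bd by (simp add: birth_death_kernel_def)
  next
    case False then show ?thesis using nn[of "Suc i"] P[of "Suc i"] i by simp
  qed
qed

lemma birth_death_kernelI:
  assumes "q 0 = 0" "p d = 0"
    and rates: "\<And>i. i \<le> d \<Longrightarrow> 0 \<le> q i \<and> 0 \<le> r i \<and> 0 \<le> p i \<and> q i + r i + p i = 1"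
    and P: "\<And>i j. P i j = (if i = Suc j then q i else if i = j then r i else if j = Suc i then p i else 0)"
  shows "birth_death_kernel d q r p P"
proof -
  have "(\<Sum>j\<le>d. P i j) = 1" if i: "i \<le> d" for i
  proof -
    have "(\<Sum>j\<le>d. P i j) = (\<Sum>j\<le>d. (if j = i - 1 then q i else 0)
        + (if j = i then r i else 0) + (if j = Suc i then p i else 0))"
      using assms(1) by (intro sum.cong) (auto simp: P)
    also have "\<dots> = q i + r i + p i"
      using assms i by (cases "i = d") (auto simp: sum.distrib)
    finally show ?thesis using rates[OF i] by simp
  qed
  then show ?thesis
    using assms by (auto simp: birth_death_kernel_def stochastic_on_def)
qed

text \<open>The tail sum beyond \<open>j\<close> changes only around the cut. It is
  \<open>p j\<close> at state \<open>j\<close> and \<open>1 - q (Suc j)\<close> at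
  \<open>Suc j\<close>, which is where the assumption enters; the other steps compare with 0 or
  1.\<close>

lemma birth_death_monotone:
  assumes bd: "birth_death_kernel d q r p P" and le: "\<And>i. i < d \<Longrightarrow> p i + q (Suc i) \<le> 1"
  shows "monotone_kernel d P"
  unfolding monotone_kernel_def
proof (intro allI impI)
  fix j i i' assume ii': "i \<le> i' \<and> i' \<le> d"
  define G where "G i = (\<Sum>k\<in>{j<..d}. P i k)" for i
  have G: "G i = q i * of_bool (j < i - 1) + r i * of_bool (j < i) + p i * of_bool (j < Suc i)"
    if "i \<le> d" for i
  proof -
    have "G i = (\<Sum>k\<le>d. P i k * of_bool (j < k))"
      unfolding G_def by (rule sum.mono_neutral_cong_left) auto
    then show ?thesis using birth_death_row_sum[OF bd that] by simp
  qed
  have step: "G i \<le> G (Suc i)" if i: "Suc i \<le> d" for i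
  proof -
    have "i \<le> d" "i < d" using i by simp_all
    note rates = birth_death_rates[OF bd this(1)] birth_death_rates[OF bd i] le[OF this(2)]
    consider "i < j" | "i = j" | "i = Suc j" | "Suc j < i" by linarith
    then show ?thesis using rates G[OF \<open>i \<le> d\<close>] G[OF i] by cases auto
  qed
  from ii' have "i \<le> i'" "i' \<le> d" by simp_all
  then have "G i \<le> G i'"
  proof (induction rule: dec_induct)
    case (step m)
    then show ?case using \<open>\<And>i. Suc i \<le> d \<Longrightarrow> G i \<le> G (Suc i)\<close>[of m] by simp
  qed simp
  then show "(\<Sum>k\<in>{j<..d}. P i k) \<le> (\<Sum>k\<in>{j<..d}. P i' k)" by (simp add: G_def)
qed

section \<open>Powers of kernels: ergodicity and absorption\<close>

lemma kernel_power_nonneg: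
  assumes "stochastic_on {..d} P" "i \<le> d" "j \<le> d"
  shows "0 \<le> kernel_power d P n i j"
  using assms(2)
proof (induction n arbitrary: i)
  case (Suc n)
  then show ?case using assms(1)
    by (auto simp: kernel_mult_def stochastic_on_def intro!: sum_nonneg)
qed simp

lemma kernel_power_Suc_pos:
  assumes P: "stochastic_on {..d} P" and ijk: "i \<le> d" "j \<le> d" "k \<le> d"
    and "0 < P i k" "0 < kernel_power d P n k j"
  shows "0 < kernel_power d P (Suc n) i j"
proof -
  have "0 < P i k * kernel_power d P n k j" using assms by simp
  also have "\<dots> \<le> (\<Sum>l\<le>d. P i l * kernel_power d P n l j)"
    using P ijk kernel_power_nonneg[OF P]
    by (intro member_le_sum) (auto simp: stochastic_on_def)
  finally show ?thesis by (simp add: kernel_mult_def)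
qed

text \<open>Powers grow by a factor on the left, so a path is extended at its start: the inductions
  let the source recede from the target one state at a time. Positive holding puts 1 among the
  return times.\<close>

lemma birth_death_ergodic:
  assumes bd: "birth_death_kernel d q r p P"
    and pos: "\<And>i. i < d \<Longrightarrow> 0 < p i" "\<And>i. i < d \<Longrightarrow> 0 < q (Suc i)" "\<And>i. i \<le> d \<Longrightarrow> 0 < r i"
  shows "ergodic_kernel d P"
proof -
  have P: "stochastic_on {..d} P" using bd by (simp add: birth_death_kernel_def)
  have entry: "P i j = (if i = Suc j then q i else if i = j then r i else if j = Suc i then p i else 0)"
    if "i \<le> d" "j \<le> d" for i j using bd that by (simp add: birth_death_kernel_def)
  have "\<exists>n. 0 < kernel_power d P n i j" if i: "i \<le> d" and j: "j \<le> d" for i j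
  proof (cases "i \<le> j")
    case True
    then show ?thesis
    proof (induction rule: inc_induct)
      case base show ?case by (intro exI[of _ 0]) simp
    next
      case (step m)
      then obtain n where "0 < kernel_power d P n (Suc m) j" by blast
      moreover have "0 < P m (Suc m)" using step j pos(1)[of m] entry[of m "Suc m"] by simp
      ultimately show ?case
        using kernel_power_Suc_pos[OF P, of m j "Suc m" n] step j by (intro exI[of _ "Suc n"]) simp
    qed
  next
    case False
    then have "j \<le> i" by simp
    then show ?thesis using i
    proof (induction rule: dec_induct)
      case base show ?case by (intro exI[of _ 0]) simp
    next
      case (step m)
      then obtain n where "0 < kernel_power d P n m j" by auto
      moreover have "0 < P (Suc m) m" using step pos(2)[of m] entry[of "Suc m" m] by simp
      ultimately show ?case
        using kernel_power_Suc_pos[OF P, of "Suc m" j m n] step j by (intro exI[of _ "Suc n"]) simp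
    qed
  qed
  moreover have "Gcd {n. 0 < n \<and> 0 < kernel_power d P n i i} = 1" if i: "i \<le> d" for i
  proof -
    have "0 < kernel_power d P (Suc 0) i i"
      using pos(3)[OF i] entry[OF i i] i by (intro kernel_power_Suc_pos[OF P i i i]) simp_all
    then have "Gcd {n. 0 < n \<and> 0 < kernel_power d P n i i} dvd 1"
      by (intro Gcd_dvd) simp
    then show ?thesis by simp
  qed
  ultimately show ?thesis
    using P by (simp add: ergodic_kernel_def irreducible_kernel_def aperiodic_kernel_def)
qed

lemma kernel_power_absorbing_mono:
  assumes P: "stochastic_on {..d} P" and abs: "absorbing_state d P" and i: "i \<le> d"
  shows "kernel_power d P n i d \<le> kernel_power d P (Suc n) i d"
  using i
proof (induction n arbitrary: i)
  case 0
  have "P i d \<le> (\<Sum>k\<le>d. P i k * of_bool (k = d))" by simp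
  then show ?case using P abs 0
    by (auto simp: kernel_mult_def stochastic_on_def absorbing_state_def)
next
  case (Suc n)
  have "kernel_power d P (Suc n) i d = (\<Sum>k\<le>d. P i k * kernel_power d P n k d)"
    by (simp add: kernel_mult_def)
  also have "\<dots> \<le> (\<Sum>k\<le>d. P i k * kernel_power d P (Suc n) k d)"
    using P Suc by (intro sum_mono mult_left_mono) (auto simp: stochastic_on_def)
  finally show ?case by (simp add: kernel_mult_def)
qed

lemma kernel_power_le_1:
  assumes P: "stochastic_on {..d} P" and i: "i \<le> d" and j: "j \<le> d"
  shows "kernel_power d P n i j \<le> 1"
  using i
proof (induction n arbitrary: i)
  case (Suc n)
  have "kernel_power d P (Suc n) i j \<le> (\<Sum>k\<le>d. P i k * 1)"
    unfolding kernel_power.simps kernel_mult_def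
    using P Suc by (intro sum_mono mult_left_mono) (auto simp: stochastic_on_def)
  then show ?case using P Suc.prems by (simp add: stochastic_on_def)
qed simp

text \<open>The limiting absorption probability is harmonic, and a harmonic function of a
  birth-and-death kernel with positive birth rates is constant.\<close>

lemma birth_death_absorption:
  assumes bd: "birth_death_kernel d q r p P" and abs: "absorbing_state d P"
    and pos: "\<And>i. i < d \<Longrightarrow> 0 < p i" and i: "i \<le> d"
  shows "(\<lambda>n. kernel_power d P n i d) \<longlonglongrightarrow> 1"
proof -
  have P: "stochastic_on {..d} P" using bd by (simp add: birth_death_kernel_def)
  define a where "a i = lim (\<lambda>n. kernel_power d P n i d)" for i
  have lim: "(\<lambda>n. kernel_power d P n i d) \<longlonglongrightarrow> a i" if i: "i \<le> d" for i
  proof -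
    have "convergent (\<lambda>n. kernel_power d P n i d)"
    proof (rule Bseq_mono_convergent)
      show "Bseq (\<lambda>n. kernel_power d P n i d)"
        using kernel_power_le_1[OF P i order_refl] kernel_power_nonneg[OF P i order_refl]
        by (intro BseqI'[of _ 1]) simp
      show "\<forall>m n. m \<le> n \<longrightarrow> kernel_power d P m i d \<le> kernel_power d P n i d"
        using lift_Suc_mono_le[of "\<lambda>n. kernel_power d P n i d"]
          kernel_power_absorbing_mono[OF P abs i] by blast
    qed
    then show ?thesis by (simp add: a_def convergent_LIMSEQ_iff)
  qed
  \<comment> \<open>The recursion of the powers conditions on the first step, so harmonicity is its
    limit.\<close>
  have harm: "a i = q i * a (i - 1) + r i * a i + p i * a (Suc i)" if i: "i \<le> d" for i
  proof -
    have "(\<lambda>n. \<Sum>k\<le>d. P i k * kernel_power d P n k d) \<longlonglongrightarrow> (\<Sum>k\<le>d. P i k * a k)"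
      by (intro tendsto_sum tendsto_mult tendsto_const lim) simp
    moreover have "(\<lambda>n. \<Sum>k\<le>d. P i k * kernel_power d P n k d) \<longlonglongrightarrow> a i"
      using LIMSEQ_Suc[OF lim[OF i]] by (simp add: kernel_mult_def)
    ultimately have "a i = (\<Sum>k\<le>d. P i k * a k)" by (rule LIMSEQ_unique[rotated])
    then show ?thesis by (simp only: birth_death_row_sum[OF bd i])
  qed
  \<comment> \<open>Harmonicity reads
    \<open>p i * (a (Suc i) - a i) = q i * (a i - a (i - 1))\<close>. The right-hand side vanishes
    at 0 because \<open>q 0 = 0\<close>, and zero increments propagate upwards.\<close>
  have flat: "a (Suc i) = a i" if "i < d" for i
    using that
  proof (induction i)
    case 0
    have "q 0 = 0" using bd by (simp add: birth_death_kernel_def)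
    moreover from this have "r 0 = 1 - p 0" using birth_death_rates(1)[OF bd, of 0] by simp
    ultimately have "a 0 = (1 - p 0) * a 0 + p 0 * a (Suc 0)" using harm[of 0] by simp
    then have "p 0 * (a (Suc 0) - a 0) = 0" by (auto simp: algebra_simps)
    then show ?case using pos[of 0] 0 by simp
  next
    case (Suc i)
    then have "a (Suc i) = (q (Suc i) + r (Suc i)) * a (Suc i) + p (Suc i) * a (Suc (Suc i))"
      using harm[of "Suc i"] by (simp add: algebra_simps)
    moreover have "q (Suc i) + r (Suc i) = 1 - p (Suc i)"
      using birth_death_rates(1)[OF bd, of "Suc i"] Suc.prems by simp
    ultimately have "p (Suc i) * (a (Suc (Suc i)) - a (Suc i)) = 0" by (auto simp: algebra_simps)
    then show ?case using pos[of "Suc i"] Suc.prems by simp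
  qed
  have "a i = a d" using i by (induction rule: inc_induct) (simp_all add: flat)
  moreover have "a d = 1"
  proof (rule LIMSEQ_unique[OF lim])
    have "kernel_power d P n d d = 1" for n
    proof (rule antisym)
      show "kernel_power d P n d d \<le> 1" by (rule kernel_power_le_1[OF P]) simp_all
      have "kernel_power d P 0 d d \<le> kernel_power d P n d d"
        using lift_Suc_mono_le[of "\<lambda>n. kernel_power d P n d d" 0 n]
          kernel_power_absorbing_mono[OF P abs, of d] by blast
      then show "1 \<le> kernel_power d P n d d" by simp
    qed
    then show "(\<lambda>n. kernel_power d P n d d) \<longlonglongrightarrow> 1" by simp
  qed simp
  ultimately show ?thesis using lim[OF i] by simp
qed

text \<open>The function \<open>x = 1 / H\<close> has to be harmonic for the dual kernel at the interior states. This
  determines its increments up to a factor \<open>c\<close>, and a small \<open>c\<close> makes all holding probabilities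
  of \<open>P\<close> positive because \<open>p (i - 1) + q i < 1\<close> is strict.\<close>

lemma harmonic_function_exists:
  fixes q p :: "nat \<Rightarrow> real"
  assumes p: "\<And>i. i < d \<Longrightarrow> 0 < p i" "\<And>i. i \<le> d \<Longrightarrow> p i \<le> 1"
    and q: "\<And>i. 0 < i \<Longrightarrow> i < d \<Longrightarrow> 0 < q i"
    and pq: "\<And>i. i < d \<Longrightarrow> p i + q (Suc i) < 1" and pd: "p d = 0"
  obtains x :: "nat \<Rightarrow> real" where "x d = 1" "\<And>i. i \<le> d \<Longrightarrow> 1 \<le> x i" "\<And>i. i < d \<Longrightarrow> x (Suc i) < x i"
    "\<And>i. 0 < i \<Longrightarrow> i < d \<Longrightarrow> q i * (x (i - 1) - x i) = p i * (x i - x (Suc i))"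
    "\<And>i. i < d \<Longrightarrow> p i * x (Suc i) / x i + (q (Suc i) + p (Suc i) * (1 - x (Suc (Suc i)) / x (Suc i))) < 1"
proof -
  \<comment> \<open>Harmonicity at \<open>i\<close> forces the ratio \<open>q i / p i\<close>
    between consecutive drops of \<open>x\<close>, so the drops are \<open>c * a i\<close> with
    \<open>a 0 = 1\<close>.\<close>
  define a where "a k = (\<Prod>l\<in>{1..k}. q l / p l)" for k
  define G where "G = (\<Sum>k<d. a k)"
  \<comment> \<open>The smallest slack in the strict inequalities; the inserted 1 keeps the set
    nonempty and positive for every \<open>d\<close>.\<close>
  define \<delta> where "\<delta> = Min (insert 1 ((\<lambda>i. 1 - p i - q (Suc i)) ` {..<d}))"
  \<comment> \<open>Chosen so that \<open>c * G \<le> \<delta> / 2\<close>; the summand 1 avoids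
    division by zero when \<open>G = 0\<close>.\<close>
  define c where "c = \<delta> / (2 * (1 + G))"
  define x where "x i = 1 + c * (\<Sum>k\<in>{i..<d}. a k)" for i
  have a: "0 < a k" if "k < d" for k
    unfolding a_def using that by (intro prod_pos) (auto intro!: divide_pos_pos p q)
  have G: "0 \<le> G" unfolding G_def using a by (intro sum_nonneg) (simp add: less_imp_le)
  have \<delta>: "0 < \<delta>" unfolding \<delta>_def using pq by (subst Min_gr_iff) (auto simp: algebra_simps)
  have \<delta>_le: "\<delta> \<le> 1 - p i - q (Suc i)" if "i < d" for i
    unfolding \<delta>_def using that by (intro Min_le) auto
  have c: "0 < c" using \<delta> G by (simp add: c_def)
  have cG: "c * G < \<delta>"
  proof -
    have "c * G \<le> c * (1 + G)" using c by simp
    also have "\<dots> = \<delta> / 2" using G by (simp add: c_def field_simps)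
    also have "\<dots> < \<delta>" using \<delta> by simp
    finally show ?thesis .
  qed
  have ca: "c * a k \<le> c * G" if "k < d" for k
    unfolding G_def using that c a by (intro mult_left_mono member_le_sum) (auto simp: less_imp_le)
  have x1: "1 \<le> x i" for i
    unfolding x_def using c a by (auto intro!: mult_nonneg_nonneg sum_nonneg simp: less_imp_le)
  have xdiff: "x i - x (Suc i) = c * a i" if "i < d" for i
    unfolding x_def using that by (simp add: sum.atLeast_Suc_lessThan algebra_simps)
  show ?thesis
  proof (rule that)
    show "x d = 1" by (simp add: x_def)
    show "1 \<le> x i" for i by (rule x1)
    show dec: "x (Suc i) < x i" if "i < d" for i
      using xdiff[OF that] mult_pos_pos[OF c a[OF that]] by linarith
    fix i :: nat
    show "q i * (x (i - 1) - x i) = p i * (x i - x (Suc i))" if i: "0 < i" "i < d"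
    proof -
      obtain j where j: "i = Suc j" using i(1) by (cases i) auto
      have "a i = a j * (q i / p i)" unfolding a_def j by (simp add: prod.cl_ivl_Suc)
      then have "p i * a i = q i * a j" using p(1)[OF i(2)] by (simp add: field_simps)
      then show ?thesis using xdiff[of j] xdiff[of i] i j by (simp add: algebra_simps)
    qed
    show "p i * x (Suc i) / x i + (q (Suc i) + p (Suc i) * (1 - x (Suc (Suc i)) / x (Suc i))) < 1"
      if i: "i < d"
    proof -
      have x0: "0 < x k" for k using x1[of k] by linarith
      \<comment> \<open>As \<open>x\<close> decreases, the first summand is at most
        \<open>p i\<close>. The last is at most one drop of \<open>x\<close>, because
        \<open>x \<ge> 1\<close> and the birth rate is at most 1, so it is below the slack \<delta>;
        at \<open>Suc i = d\<close> it vanishes with \<open>p d\<close>.\<close>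
      have "p i * x (Suc i) / x i \<le> p i"
        using p(1)[OF i] dec[OF i] x0[of i] by (simp add: field_simps)
      moreover have "p (Suc i) * (1 - x (Suc (Suc i)) / x (Suc i)) \<le> c * G"
      proof (cases "Suc i = d")
        case True then show ?thesis using pd c G by simp
      next
        case False
        then have i': "Suc i < d" using i by simp
        have "1 - x (Suc (Suc i)) / x (Suc i) = (c * a (Suc i)) / x (Suc i)"
          using xdiff[OF i'] x0[of "Suc i"] by (simp add: field_simps)
        also have "\<dots> \<le> c * a (Suc i)"
          using x1[of "Suc i"] mult_pos_pos[OF c a[OF i']]
          by (intro mult_imp_div_pos_le) (auto simp: mult_le_cancel_left1)
        also have "\<dots> \<le> c * G" by (rule ca[OF i'])
        finally have "1 - x (Suc (Suc i)) / x (Suc i) \<le> c * G" .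
        moreover have "0 \<le> c * G" using c G by simp
        ultimately have "p (Suc i) * (1 - x (Suc (Suc i)) / x (Suc i)) \<le> p (Suc i) * (c * G)"
          using p(1)[OF i'] by (intro mult_left_mono) auto
        also have "\<dots> \<le> 1 * (c * G)"
          using p(2)[of "Suc i"] i' \<open>0 \<le> c * G\<close> by (intro mult_right_mono) auto
        finally show ?thesis by simp
      qed
      ultimately show ?thesis using cG \<delta>_le[OF i] by linarith
    qed
  qed
qed

section \<open>The kernel \<open>P\<close> built from the harmonic function\<close>

lemma classical_dual_exists:
  assumes d: "1 \<le> d"
    and bd: "birth_death_kernel d qs rs ps Ps"
    and abs: "absorbing_state d Ps"
    and ps_pos: "\<forall>i\<le>d - 1. 0 < ps i"
    and qs_pos: "\<forall>i\<in>{1..d - 1}. 0 < qs i"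
    and strict: "\<forall>i\<in>{1..d}. ps (i - 1) + qs i < 1"
  obtains P q r p \<pi> where "birth_death_kernel d q r p P" "ergodic_kernel d P" "monotone_kernel d P"
    "stationary_distribution d P \<pi>" "classical_ssd d P \<pi> Ps" "\<forall>i\<le>d. 0 < \<pi> i"
proof -
  have ps: "0 < ps i" if "i < d" for i using ps_pos that by auto
  have qs: "0 < qs i" if "0 < i" "i < d" for i using qs_pos that by auto
  have pqs: "ps i + qs (Suc i) < 1" if "i < d" for i using strict that by force
  have ends: "qs 0 = 0" "ps d = 0" using bd by (simp_all add: birth_death_kernel_def)
  note rates = birth_death_rates[OF bd]
  have ps1: "ps i \<le> 1" if "i \<le> d" for i using rates[OF that] by linarith
  obtain x where xd: "x d = 1" and x1: "\<And>i. i \<le> d \<Longrightarrow> 1 \<le> x i"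
    and dec: "\<And>i. i < d \<Longrightarrow> x (Suc i) < x i"
    and harm: "\<And>i. 0 < i \<Longrightarrow> i < d \<Longrightarrow> qs i * (x (i - 1) - x i) = ps i * (x i - x (Suc i))"
    and small: "\<And>i. i < d \<Longrightarrow>
      ps i * x (Suc i) / x i + (qs (Suc i) + ps (Suc i) * (1 - x (Suc (Suc i)) / x (Suc i))) < 1"
    by (rule harmonic_function_exists[where p = ps and q = qs and d = d, OF ps ps1 qs pqs ends(2)])
      (assumption | blast)+
  have x0: "0 < x i" if "i \<le> d" for i using x1[OF that] by linarith
  \<comment> \<open>For interior \<open>i\<close> this equals \<open>qs i * x (i - 1) / x i\<close>
    by harmonicity, the rate read off from the classical dual. The form chosen here is also right at
    0, where \<open>qs 0 = 0\<close> carries no information, and at \<open>d\<close>, where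
    \<open>ps d = 0\<close> silences \<open>x (Suc d)\<close>.\<close>
  define p where "p i = qs i + ps i * (1 - x (Suc i) / x i)" for i
  define q where "q i = (case i of 0 \<Rightarrow> 0 | Suc j \<Rightarrow> ps j * x (Suc j) / x j)" for i
  define r where "r i = 1 - q i - p i" for i
  define P where "P i j = (if i = Suc j then q i else if i = j then r i else if j = Suc i then p i else 0)"
    for i j
  define \<pi> where "\<pi> i = (case i of 0 \<Rightarrow> 1 / x 0 | Suc j \<Rightarrow> 1 / x (Suc j) - 1 / x j)" for i
  have q0: "q 0 = 0" and qSuc: "q (Suc j) = ps j * x (Suc j) / x j" for j by (simp_all add: q_def)
  have \<pi>0: "\<pi> 0 = 1 / x 0" and \<pi>Suc: "\<pi> (Suc j) = 1 / x (Suc j) - 1 / x j" for j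
    by (simp_all add: \<pi>_def)
  have H: "(\<Sum>i\<le>n. \<pi> i) = 1 / x n" for n by (induction n) (simp_all add: \<pi>0 \<pi>Suc)
  \<comment> \<open>This gives \<open>p d = 0\<close> and makes the harmonic equation trivially true
    at \<open>d\<close>.\<close>
  have qsd: "qs d = 0"
  proof -
    have "rs d = 1" using bd abs by (simp add: birth_death_kernel_def absorbing_state_def)
    then show ?thesis using rates[of d] by linarith
  qed
  have pd: "p d = 0" by (simp add: p_def qsd ends)
  have p_pos: "0 < p i" if i: "i < d" for i
  proof -
    have "0 < 1 - x (Suc i) / x i" using dec[OF i] x0[of i] i by simp
    then have "0 < ps i * (1 - x (Suc i) / x i)" using ps[OF i] by simp
    then show ?thesis using rates(2)[of i] i by (simp add: p_def)
  qed
  have q_pos: "0 < q (Suc i)" if "i < d" for i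
    using that ps x0[of i] x0[of "Suc i"] by (simp add: qSuc)
  \<comment> \<open>At 0 it is enough that \<open>r 0 = 1 - ps 0 + ps 0 * x 1 / x 0\<close>;
    elsewhere positivity is the smallness property of \<open>x\<close>.\<close>
  have r_pos: "0 < r i" if i: "i \<le> d" for i
  proof (cases i)
    case 0
    have "0 < x 1 / x 0" using x0[of 0] x0[of 1] d by simp
    moreover have "0 < ps 0" "ps 0 \<le> 1" using ps[of 0] ps1[of 0] d by auto
    ultimately have "0 < ps 0 * (x 1 / x 0)" by (intro mult_pos_pos)
    then show ?thesis using 0 \<open>ps 0 \<le> 1\<close> by (simp add: r_def q0 p_def ends algebra_simps)
  next
    case (Suc j)
    then show ?thesis using small[of j] i by (simp add: r_def qSuc p_def)
  qed
  have bdP: "birth_death_kernel d q r p P"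
  proof (rule birth_death_kernelI)
    fix i assume i: "i \<le> d"
    have "0 \<le> q i" using q_pos i q0 by (cases i) (auto simp: less_imp_le)
    moreover have "0 \<le> p i" using p_pos[of i] i pd by (cases "i = d") auto
    ultimately show "0 \<le> q i \<and> 0 \<le> r i \<and> 0 \<le> p i \<and> q i + r i + p i = 1"
      using r_pos[OF i] by (simp add: r_def)
  qed (simp_all add: q0 pd P_def)
  have ergP: "ergodic_kernel d P" using birth_death_ergodic[OF bdP p_pos q_pos r_pos] .
  \<comment> \<open>The drops of \<open>x\<close> cancel in the sum, leaving
    \<open>1 - rs i\<close>; monotonicity of \<open>P\<close> is thus nonnegativity of the holding
    rates of the dual.\<close>
  have pq: "p i + q (Suc i) = ps i + qs i" if "i < d" for i
    using that x0[of i] by (simp add: p_def qSuc field_simps)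
  have monP: "monotone_kernel d P"
  proof (rule birth_death_monotone[OF bdP])
    fix i assume i: "i < d"
    then show "p i + q (Suc i) \<le> 1" using pq[OF i] rates[of i] by simp
  qed
  have \<pi>_pos: "0 < \<pi> i" if "i \<le> d" for i
  proof (cases i)
    case 0 then show ?thesis using x0[of 0] by (simp add: \<pi>0)
  next
    case (Suc j)
    then show ?thesis using that dec[of j] x0[of j] x0[of "Suc j"] by (simp add: \<pi>Suc frac_less2)
  qed
  \<comment> \<open>Both sides equal \<open>ps i * (x i - x (Suc i)) / (x i * x i)\<close>; on the
    left, harmonicity exchanges the drop above \<open>i\<close> for the one below it.\<close>
  have balance: "\<pi> i * p i = \<pi> (Suc i) * q (Suc i)" if i: "i < d" for i
  proof -
    have X: "0 < x i" "0 < x (Suc i)" using x0 i by simp_all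
    have r: "\<pi> (Suc i) * q (Suc i) = ps i * (x i - x (Suc i)) / (x i * x i)"
      using X by (simp add: \<pi>Suc qSuc field_simps)
    show ?thesis
    proof (cases i)
      case 0
      then show ?thesis unfolding r using X by (simp add: \<pi>0 p_def ends field_simps)
    next
      case (Suc j)
      have Y: "0 < x j" using x0 i Suc by simp
      have h: "qs i * (x j - x i) = ps i * (x i - x (Suc i))" using harm[of i] i Suc by simp
      have "p i = (qs i * x i + ps i * (x i - x (Suc i))) / x i"
        using X by (simp add: p_def field_simps)
      also have "\<dots> = qs i * x j / x i" unfolding h[symmetric] by (simp add: algebra_simps)
      finally have "\<pi> i * p i = qs i * (x j - x i) / (x i * x i)"
        using X Y Suc by (simp add: \<pi>Suc field_simps)
      then show ?thesis unfolding r h by simp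
    qed
  qed
  have rev: "\<pi> i * P i j = \<pi> j * P j i" if "i \<le> d" "j \<le> d" for i j
    using that balance[of i] balance[of j] by (auto simp: P_def)
  have stP: "stochastic_on {..d} P" using bdP by (simp add: birth_death_kernel_def)
  have stat: "stationary_distribution d P \<pi>"
    unfolding stationary_distribution_def
  proof (intro conjI allI impI)
    fix j assume j: "j \<le> d"
    have "(\<Sum>i\<le>d. \<pi> i * P i j) = (\<Sum>i\<le>d. \<pi> j * P j i)" using rev j by (intro sum.cong) auto
    also have "\<dots> = \<pi> j" using stP j by (simp add: stochastic_on_def flip: sum_distrib_left)
    finally show "(\<Sum>i\<le>d. \<pi> i * P i j) = \<pi> j" .
  qed (use \<pi>_pos H[of d] xd in \<open>auto simp: less_imp_le\<close>)
  have link: "truncated_link \<pi> i j = of_bool (j \<le> i) * \<pi> j * x i" if "i \<le> d" for i j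
    using x0[OF that] by (simp add: truncated_link_def H)
  have dual: "kernel_mult d (truncated_link \<pi>) P i j = kernel_mult d Ps (truncated_link \<pi>) i j"
    if i: "i \<le> d" and j: "j \<le> d" for i j
  proof -
    \<comment> \<open>Reversibility turns the sum over column \<open>j\<close> of \<open>P\<close>
      into one over row \<open>j\<close>, where only three entries survive.\<close>
    have "kernel_mult d (truncated_link \<pi>) P i j = (\<Sum>k\<le>d. x i * \<pi> j * (P j k * of_bool (k \<le> i)))"
      unfolding kernel_mult_def
    proof (rule sum.cong[OF refl])
      fix k assume k: "k \<in> {..d}"
      have "truncated_link \<pi> i k * P k j = x i * of_bool (k \<le> i) * (\<pi> k * P k j)"
        using link[OF i, of k] by simp
      also have "\<pi> k * P k j = \<pi> j * P j k" using rev k j by simp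
      finally show "truncated_link \<pi> i k * P k j = x i * \<pi> j * (P j k * of_bool (k \<le> i))"
        by (simp add: mult_ac)
    qed
    also have "\<dots> = x i * \<pi> j * (q j * of_bool (j - 1 \<le> i) + r j * of_bool (j \<le> i) + p j * of_bool (Suc j \<le> i))"
      using birth_death_row_sum[OF bdP j, of "\<lambda>k. of_bool (k \<le> i)"]
      by (simp flip: sum_distrib_left)
    finally have lhs: "kernel_mult d (truncated_link \<pi>) P i j = \<dots>" .
    have rhs: "kernel_mult d Ps (truncated_link \<pi>) i j
        = \<pi> j * (qs i * (of_bool (j \<le> i - 1) * x (i - 1)) + rs i * (of_bool (j \<le> i) * x i)
            + ps i * (of_bool (j \<le> Suc i) * x (Suc i)))"
    proof -
      have "kernel_mult d Ps (truncated_link \<pi>) i j = (\<Sum>k\<le>d. \<pi> j * (Ps i k * (of_bool (j \<le> k) * x k)))"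
        unfolding kernel_mult_def by (rule sum.cong[OF refl]) (simp add: link)
      also have "\<dots> = \<pi> j * (\<Sum>k\<le>d. Ps i k * (of_bool (j \<le> k) * x k))"
        by (simp add: sum_distrib_left)
      finally show ?thesis using birth_death_row_sum[OF bd i, of "\<lambda>k. of_bool (j \<le> k) * x k"] by simp
    qed
    have rsi: "rs i = 1 - qs i - ps i" using rates(1)[OF i] by simp
    \<comment> \<open>Below the diagonal the identity is harmonicity of \<open>x\<close>, on it the
      definition of \<open>p\<close>, just above it the definition of \<open>q\<close>; beyond that
      both sides vanish.\<close>
    consider "j < i" | "j = i" | "j = Suc i" | "Suc i < j" by linarith
    then show ?thesis
    proof cases
      case 1
      have h: "qs i * (x (i - 1) - x i) = ps i * (x i - x (Suc i))"
        using harm[of i] 1 i ends qsd by (cases "i = d") auto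
      have "kernel_mult d (truncated_link \<pi>) P i j = x i * \<pi> j"
      proof -
        have "j - 1 \<le> i" using 1 by linarith
        then show ?thesis unfolding lhs using 1 by (simp add: r_def)
      qed
      also have "x i = qs i * x (i - 1) + rs i * x i + ps i * x (Suc i)"
        using h unfolding rsi by (simp add: algebra_simps)
      finally have "kernel_mult d (truncated_link \<pi>) P i j
          = (qs i * x (i - 1) + rs i * x i + ps i * x (Suc i)) * \<pi> j" .
      moreover have "j \<le> i - 1" using 1 by linarith
      ultimately show ?thesis unfolding rhs using 1 by simp
    next
      case 2
      have "kernel_mult d (truncated_link \<pi>) P i j = \<pi> i * (x i * (1 - p i))"
        unfolding lhs using 2 by (simp add: r_def)
      also have "x i * (1 - p i) = rs i * x i + ps i * x (Suc i)"
        using x0[OF i] unfolding rsi by (simp add: p_def field_simps)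
      finally show ?thesis unfolding rhs using 2 ends by (cases i) simp_all
    next
      case 3
      have "\<not> j \<le> i - 1" using 3 by linarith
      moreover have "kernel_mult d (truncated_link \<pi>) P i j = \<pi> j * (x i * q (Suc i))"
        unfolding lhs using 3 by simp
      moreover have "x i * q (Suc i) = ps i * x (Suc i)" using x0[OF i] by (simp add: qSuc)
      ultimately show ?thesis unfolding rhs using 3 by simp
    next
      case 4
      then have "\<not> j \<le> i - 1" "\<not> j - 1 \<le> i" by linarith+
      then show ?thesis unfolding lhs rhs using 4 by simp
    qed
  qed
  have "classical_ssd d P \<pi> Ps"
    unfolding classical_ssd_def strong_stationary_dual_def
  proof (intro conjI allI impI)
    show "stochastic_on {..d} Ps" using bd by (simp add: birth_death_kernel_def)
    show "stochastic_on {..d} (truncated_link \<pi>)"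
      unfolding stochastic_on_def
    proof (intro ballI conjI)
      fix i j assume "i \<in> {..d}" "j \<in> {..d}"
      then show "0 \<le> truncated_link \<pi> i j"
        using link[of i j] x0[of i] \<pi>_pos[of j] by simp
    next
      fix i assume "i \<in> {..d}"
      then have i: "i \<le> d" by simp
      have "(\<Sum>j\<le>d. truncated_link \<pi> i j) = (\<Sum>j\<le>i. \<pi> j * x i)"
        using i by (intro sum.mono_neutral_cong_right) (auto simp: link)
      also have "\<dots> = 1" using H[of i] x0[OF i] by (simp flip: sum_distrib_right)
      finally show "(\<Sum>j\<le>d. truncated_link \<pi> i j) = 1" .
    qed
    show "truncated_link \<pi> 0 j = of_bool (j = 0)" for j
      using link[of 0 j] x0[of 0] by (cases j) (simp_all add: \<pi>0)
    show "truncated_link \<pi> d j = \<pi> j" if "j \<le> d" for j using that link[of d j] xd by simp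
  qed (use ergP stat abs dual in simp_all)
  then show thesis using that bdP ergP monP stat \<pi>_pos by blast
qed

theorem theorem3p1:
  fixes d :: nat
    and Pstar :: "nat \<Rightarrow> nat \<Rightarrow> real"
    and qstar rstar pstar :: "nat \<Rightarrow> real"
  assumes "1 \<le> d"
    and "birth_death_kernel d qstar rstar pstar Pstar"
    and "absorbing_state d Pstar"
    and "\<forall>i\<le>d - 1. 0 < pstar i"
    and "\<forall>i\<in>{1..d - 1}. 0 < qstar i"
    and "\<forall>i\<in>{1..d}. pstar (i - 1) + qstar i < 1"
  shows "\<exists>P q r p \<pi>.
           birth_death_kernel d q r p P \<and> ergodic_kernel d P \<and> monotone_kernel d P \<and>
           stationary_distribution d P \<pi> \<and>
           classical_ssd d P \<pi> Pstar \<and> sharp_dual d P \<pi> Pstar"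
proof -
  obtain P q r p \<pi> where P: "birth_death_kernel d q r p P" "ergodic_kernel d P" "monotone_kernel d P"
    "stationary_distribution d P \<pi>" "classical_ssd d P \<pi> Pstar" and pos: "\<forall>i\<le>d. 0 < \<pi> i"
    by (rule classical_dual_exists[OF assms])
  have "sharp_dual d P \<pi> Pstar"
  proof (rule strong_stationary_dual_sharp)
    show "strong_stationary_dual d P \<pi> (truncated_link \<pi>) Pstar"
      using P(5) unfolding classical_ssd_def .
    show "(\<lambda>n. kernel_power d Pstar n 0 d) \<longlonglongrightarrow> 1"
      by (rule birth_death_absorption[OF assms(2,3)]) (use assms(4) in auto)
  \<comment> \<open>Row \<open>i\<close> of the truncated link is supported on \<open>{..i}\<close>,
    so its entry at \<open>d\<close> vanishes for \<open>i < d\<close>.\<close>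
  qed (use pos in \<open>simp_all add: truncated_link_def\<close>)
  with P show ?thesis by (intro exI conjI)
qed

end
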